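(* Let $GW_N$ be a generalized wheel with $k$ groups and $2n$ vertices. If every family of $\frac{k-1}{2}$ consecutive groups contains strictly fewer than $n-2$ vertices, then the edges of $GW_N$ cannot be partitioned into plane spanning trees.
   Context: A geometric graph is a graph drawn in the plane whose vertices are points in general position and whose edges are straight-line segments; it is plane if no two edges share a point of their relative interiors. A partition of a graph is a set of edge-disjoint subgraphs whose union is the graph; a spanning tree is a tree containing all vertices. Let $k\ge 3$ be odd and $N=[n_1,\dots,n_k]$ with integers $n_i\ge 1$ and $\sum_i n_i$ odd. The generalized wheel $GW_N$ is the complete geometric graph on the point set consisting of a center point $v_0$ together with $k$ groups $\mathcal{G}_1,\dots,\mathcal{G}_k$ (in this circular order), where group $\mathcal{G}_i$ consists of $n_i$ points that are $\varepsilon$-close (for sufficiently small $\varepsilon>0$) to the $i$-th vertex of a regular $k$-gon centered at $v_0$, all points other than $v_0$ lie on the convex hull in convex position, and $v_0$ is the only interior point. Its number of vertices is $2n = 1+\sum_i n_i$. Group indices are taken modulo $k$; a family of $\frac{k-1}{2}$ consecutive groups is a set $\{\mathcal{G}_j,\mathcal{G}_{j+1},\dots,\mathcal{G}_{j+\frac{k-3}{2}}\}$. *)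

theory Defs
  imports "HOL-Analysis.Analysis"
begin

text \<open>
  A geometric graph is given by its vertex set, a set of points of the plane, and its edge set,
  where an edge is the two-element set of its endpoints.
\<close>

definition complete_edges :: "'a set \<Rightarrow> 'a set set" where
  "complete_edges V = {{u, v} | u v. u \<in> V \<and> v \<in> V \<and> u \<noteq> v}"

definition connected_graph :: "'a set \<Rightarrow> 'a set set \<Rightarrow> bool" where
  "connected_graph V E \<longleftrightarrow> (\<forall>u\<in>V. \<forall>v\<in>V. (u, v) \<in> {(x, y). {x, y} \<in> E}\<^sup>*)"

definition graph_cycle :: "'a set set \<Rightarrow> 'a list \<Rightarrow> bool" where
  "graph_cycle E vs \<longleftrightarrow> 3 \<le> length vs \<and> distinct vs \<and>
     (\<forall>i<length vs. {vs ! i, vs ! (Suc i mod length vs)} \<in> E)"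

definition spanning_tree :: "'a set \<Rightarrow> 'a set set \<Rightarrow> 'a set set \<Rightarrow> bool" where
  "spanning_tree V E T \<longleftrightarrow> T \<subseteq> E \<and> connected_graph V T \<and> (\<nexists>vs. graph_cycle T vs)"

text \<open>The relative interior of the segment with distinct endpoints \<open>a\<close>, \<open>b\<close> is \<open>open_segment a b\<close>.\<close>

definition plane_edges :: "complex set set \<Rightarrow> bool" where
  "plane_edges E \<longleftrightarrow> (\<forall>a b c d. {a, b} \<in> E \<longrightarrow> {c, d} \<in> E \<longrightarrow> {a, b} \<noteq> {c, d} \<longrightarrow>
     open_segment a b \<inter> open_segment c d = {})"

definition partitionable_into_plane_spanning_trees :: "complex set \<Rightarrow> complex set set \<Rightarrow> bool" where
  "partitionable_into_plane_spanning_trees V E \<longleftrightarrow>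
     (\<exists>\<T>. partition_on E \<T> \<and> (\<forall>T\<in>\<T>. spanning_tree V E T \<and> plane_edges T))"

definition general_position :: "complex set \<Rightarrow> bool" where
  "general_position V \<longleftrightarrow>
     (\<forall>a\<in>V. \<forall>b\<in>V. \<forall>c\<in>V. a \<noteq> b \<longrightarrow> a \<noteq> c \<longrightarrow> b \<noteq> c \<longrightarrow> \<not> collinear {a, b, c})"

text \<open>
  For \<open>z \<noteq> 0\<close>, the points with \<open>i < k\<close> are the vertices, in counterclockwise order, of the regular
  \<open>k\<close>-gon with center \<open>c\<close> whose \<open>0\<close>-th vertex is \<open>c + z\<close>.
\<close>

definition regular_polygon_vertex :: "complex \<Rightarrow> complex \<Rightarrow> nat \<Rightarrow> nat \<Rightarrow> complex" where
  "regular_polygon_vertex c z k i = c + z * cis (2 * pi * real i / real k)"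

definition wheel_points :: "nat list \<Rightarrow> complex \<Rightarrow> (nat \<Rightarrow> complex set) \<Rightarrow> complex set" where
  "wheel_points N v0 G = insert v0 (\<Union>i<length N. G i)"

text \<open>
  The groups \<open>G 0, \<dots>, G (k - 1)\<close> realize, together with the center \<open>v0\<close>, the vertex set of the
  generalized wheel with group sizes \<open>N\<close>, where \<open>k\<close> is the length of \<open>N\<close>. The vector \<open>z\<close> points
  from \<open>v0\<close> to the \<open>0\<close>-th vertex of the regular polygon, and \<open>\<epsilon>\<close> bounds the distance of the points
  of a group from the corresponding vertex. This is the intended notion only for all sufficiently
  small \<open>\<epsilon> > 0\<close>.
\<close>

definition generalized_wheel ::
    "nat list \<Rightarrow> complex \<Rightarrow> complex \<Rightarrow> real \<Rightarrow> (nat \<Rightarrow> complex set) \<Rightarrow> bool" where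
  "generalized_wheel N v0 z \<epsilon> G \<longleftrightarrow>
     (\<forall>i<length N. finite (G i) \<and> card (G i) = N ! i \<and>
        (\<forall>p\<in>G i. dist p (regular_polygon_vertex v0 z (length N) i) < \<epsilon>)) \<and>
     disjoint_family_on G {..<length N} \<and>
     general_position (wheel_points N v0 G) \<and>
     (\<forall>i<length N. \<forall>p\<in>G i. p extreme_point_of (convex hull (wheel_points N v0 G))) \<and>
     v0 \<in> interior (convex hull (wheel_points N v0 G))"

end

(*
  List the hull points in circular order and lift their indices to the integers. A chord is recorded
  as the arc of the hull on the side not containing the center; such an arc meets at most h + 1
  consecutive groups, where k = 2h + 1. In a plane spanning tree the arcs are laminar and every point
  strictly inside an arc is not joined to the center. Each maximal arc (spine) has a hull edge below
  it, and there are 2n - 1 hull edges for n trees, so some tree has a single spine; it contains all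
  radial edges of h consecutive groups, and since only 2n - 1 radial edges are available such a tree
  is unique. Counting hull edges again, every other tree has exactly two spines, and below a spine the
  arcs form a chain whose lengths decrease by one (zigzag).

  Since no other tree may use a radial edge of the h groups absorbed by the exceptional tree, the two
  spines of another tree either meet inside one of the remaining h + 1 groups and end at the last,
  respectively first, point of two groups, or they leave a gap at a boundary between two of the
  remaining groups, and then one of the two points at this boundary is joined to the center in this
  tree. Counting arcs of lengths n - 1 and n at such a boundary against the radial edges near it, all
  radial edges are used up and two different spines of length n - 1 (or n - 2) are forced
  between the two extreme groups, where the zigzag property permits only one.
*)

theory Submission
  imports Defs
begin

section \<open>Acyclic graphs\<close>

text \<open>The bound n - 3 makes arcs of length n - 1 and n rigid: h groups are too few for such an
  arc, and h + 1 groups have at most 2n - 6 points. So it runs from the first to the last group of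
  one window, and two different ones of equal length in a window cross. The lengths n - 1 and n are
  paired because they add up to the 2n - 1 hull points: an arc of one length starting right of a
  boundary and one of the other length ending left of it cross as well, so all these arcs have
  different trees. The obstacle is the radial edge that the exceptional tree may miss at the rim of
  its range. Its tree \<open>t1\<close> escapes the analysis of gaps and leaves every boundary count
  a slack of one. Hence two lengths, n - 1 and n - 2, are tested at the extreme groups, and each of
  them costs one unit. If k = 3, both boundaries coincide and the two ways to pair n - 1 with n
  already contradict each other. Otherwise each of the two outermost boundaries bears exactly one
  unit, so \<open>t1\<close> has a long arc at both, and these cross.\<close>

lemma complete_edges_eq: "complete_edges V = {e. e \<subseteq> V \<and> card e = 2}"
  unfolding complete_edges_def by (auto simp: card_2_iff) 

lemma card_complete_edges: "finite V \<Longrightarrow> card (complete_edges V) = card V choose 2"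
  unfolding complete_edges_eq by (rule n_subsets)

text \<open>An end of a longest path has all its neighbours on the path, and any neighbour other
  than the next vertex would close a cycle.\<close>

lemma acyclic_low_degree:
  assumes "finite V" "V \<noteq> {}" "E \<subseteq> complete_edges V" "\<nexists>vs. graph_cycle E vs"
  obtains v w where "v \<in> V" "\<And>e. e \<in> E \<Longrightarrow> v \<in> e \<Longrightarrow> e = {v, w}"
proof -
  define path where "path vs \<longleftrightarrow> vs \<noteq> [] \<and> distinct vs \<and> set vs \<subseteq> V \<and> (\<forall>i. Suc i < length vs \<longrightarrow> {vs ! i, vs ! Suc i} \<in> E)" for vs
  obtain v0 where "v0 \<in> V" using assms(2) by auto
  then have p0: "path [v0]" unfolding path_def by simp
  have bd: "\<forall>vs. path vs \<longrightarrow> length vs \<le> card V"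
    unfolding path_def using assms(1) by (metis card_mono distinct_card)
  obtain vs where vs: "path vs" and mx: "\<And>ws. path ws \<Longrightarrow> length ws \<le> length vs"
    using ex_has_greatest_nat[of path "[v0]" length "Suc (card V)"] p0 bd by (metis less_Suc_eq_le)
  obtain x xs where x: "vs = x # xs" using vs unfolding path_def by (cases vs) auto
  have e1: "e = {x, vs ! 1}" if e: "e \<in> E" "x \<in> e" for e
  proof -
    obtain y where y: "e = {x, y}" "y \<in> V" "y \<noteq> x"
      using e assms(3) unfolding complete_edges_def by auto
    have "y \<in> set vs"
    proof (rule ccontr)
      assume ny: "y \<notin> set vs"
      have "{(y # vs) ! i, (y # vs) ! Suc i} \<in> E" if "Suc i < length (y # vs)" for i
        using that vs e(1) y(1) x unfolding path_def by (cases i) (auto simp: insert_commute)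
      then have "path (y # vs)" using vs ny y(2) unfolding path_def by simp
      then show False using mx[of "y # vs"] by simp
    qed
    then obtain j where j: "j < length vs" "vs ! j = y" by (auto simp: in_set_conv_nth)
    have "j \<noteq> 0" using j y(3) x by (cases j) auto
    moreover have "\<not> 2 \<le> j"
    proof
      assume j2: "2 \<le> j"
      have "graph_cycle E (take (Suc j) vs)"
        unfolding graph_cycle_def
      proof (intro conjI allI impI)
        show "3 \<le> length (take (Suc j) vs)" using j j2 by simp
        show "distinct (take (Suc j) vs)" using vs unfolding path_def by simp
        fix i assume i: "i < length (take (Suc j) vs)"
        then have ij: "i \<le> j" using j by simp
        have len: "length (take (Suc j) vs) = Suc j" using j by simp
        have x0: "vs ! 0 = x" using x by simp
        show "{take (Suc j) vs ! i, take (Suc j) vs ! (Suc i mod length (take (Suc j) vs))} \<in> E"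
        proof (cases "i = j")
          case True
          then show ?thesis unfolding len using j e(1) y(1) x0 by (simp add: insert_commute)
        next
          case False
          then show ?thesis unfolding len using ij j vs unfolding path_def by simp
        qed
      qed
      then show False using assms(4) by blast
    qed
    ultimately have "j = 1" by simp
    then show ?thesis using y(1) j(2) by simp
  qed
  \<comment> \<open>On a one-vertex path \<open>vs ! 1\<close> is unspecified, but then
    \<open>x\<close> has no edge at all.\<close>
  show ?thesis by (rule that[of x "vs ! 1"]) (use vs x e1 in \<open>auto simp: path_def\<close>)
qed

text \<open>Induction: a vertex of degree at most one is removed together with its edge.\<close>

lemma acyclic_card:
  assumes "finite V" "V \<noteq> {}" "E \<subseteq> complete_edges V" "\<nexists>vs. graph_cycle E vs"
  shows "card E < card V"
  using assms
proof (induction "card V" arbitrary: V E rule: less_induct)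
  case less
  obtain v w where v: "v \<in> V" "\<And>e. e \<in> E \<Longrightarrow> v \<in> e \<Longrightarrow> e = {v, w}"
    using acyclic_low_degree[OF less(2-5)] by blast
  have finE: "finite E"
    using finite_subset[OF less(4)] less(2) finite_subset[of "complete_edges V" "Pow V"]
    unfolding complete_edges_eq by auto
  define E' where "E' = {e \<in> E. v \<notin> e}"
  have sub: "E \<subseteq> insert {v, w} E'" unfolding E'_def using v(2) by blast
  have finE': "finite E'" using finE unfolding E'_def by simp
  have c: "card E \<le> Suc (card E')"
    using card_mono[OF _ sub] finE' by (simp add: card_insert_if split: if_splits)
  have E'V: "E' \<subseteq> complete_edges (V - {v})" using less(4) unfolding E'_def complete_edges_def by blast
  show ?case
  proof (cases "V - {v} = {}")
    case True
    then have V: "V = {v}" using v(1) by auto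
    then have "E = {}" using less(4) unfolding complete_edges_def by auto
    then show ?thesis using V by simp
  next
    case False
    have "\<nexists>vs. graph_cycle E' vs" using less(5) unfolding graph_cycle_def E'_def by blast
    moreover have lt: "card (V - {v}) < card V" by (rule card_Diff1_less[OF less(2) v(1)])
    ultimately have "card E' < card (V - {v})"
      using less(1)[OF lt _ False E'V] less(2) by simp
    then show ?thesis using c v(1) less(2) by simp
  qed
qed

lemma rtrancl_leaves:
  assumes "(u, v) \<in> R\<^sup>*" "u \<in> U" "v \<notin> U"
  obtains x y where "(x, y) \<in> R" "x \<in> U" "y \<notin> U"
  using assms by (induction arbitrary: thesis rule: converse_rtrancl_induct) blast+

section \<open>Crossings of chords and radial edges\<close>

text \<open>Twice the signed area of the triangle, positive for counterclockwise order.\<close>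

definition orient :: "complex \<Rightarrow> complex \<Rightarrow> complex \<Rightarrow> real" where
  "orient a b c = Im (cnj (b - a) * (c - a))"

lemma orient_rotate: "orient a b c = orient b c a"
  unfolding orient_def by (simp add: algebra_simps)

text \<open>The diagonals of the quadrilateral \<open>a\<close>, \<open>c\<close>, \<open>b\<close>,
  \<open>d\<close> divide each other in the ratio of the areas of the triangles they cut off, so the
  common point can be written down.\<close>

lemma segments_cross:
  assumes "0 < orient a b d" "0 < orient a c b" "0 < orient a c d" "0 < orient c b d"
  shows "open_segment a b \<inter> open_segment c d \<noteq> {}"
proof -
  define p q r s where "p = orient a b d" and "q = orient a c b" and "r = orient a c d" and "s = orient c b d"
  have pos: "0 < p" "0 < q" "0 < r" "0 < s" using assms unfolding p_def q_def r_def s_def by auto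
  \<comment> \<open>Both sums are twice the area of the quadrilateral.\<close>
  have sum: "p + q = r + s" unfolding p_def q_def r_def s_def orient_def by (simp add: algebra_simps)
  have id: "p *\<^sub>R c + q *\<^sub>R d = r *\<^sub>R b + s *\<^sub>R a"
    unfolding p_def q_def r_def s_def orient_def complex_eq_iff by (simp add: algebra_simps)
  define t where "t = p + q"
  have t: "t = r + s" "0 < t" using sum pos unfolding t_def by auto
  define X where "X = (1 / t) *\<^sub>R (p *\<^sub>R c + q *\<^sub>R d)"
  have ab: "a \<noteq> b" using assms(1) unfolding orient_def by auto
  have cd: "c \<noteq> d" using assms(3) unfolding orient_def by (auto simp: algebra_simps)
  have "X = (1 - q / t) *\<^sub>R c + (q / t) *\<^sub>R d"
  proof -
    have "1 - q / t = p / t" using t pos unfolding t_def by (simp add: field_simps)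
    then show ?thesis unfolding X_def by (simp add: scaleR_right_distrib divide_inverse mult.commute)
  qed
  moreover have "0 < q / t" "q / t < 1" using pos unfolding t_def by (auto simp: field_simps)
  ultimately have 1: "X \<in> open_segment c d" using cd unfolding in_segment(2) by blast
  have "X = (1 - r / t) *\<^sub>R a + (r / t) *\<^sub>R b"
  proof -
    have "1 - r / t = s / t" using t pos by (simp add: field_simps)
    then show ?thesis unfolding X_def id by (simp add: scaleR_right_distrib divide_inverse mult.commute)
  qed
  moreover have "0 < r / t" "r / t < 1" using pos t by (auto simp: field_simps)
  ultimately have "X \<in> open_segment a b" using ab unfolding in_segment(2) by blast
  then show ?thesis using 1 by blast
qed

text \<open>Scaling \<open>c - v\<close> by \<open>1 / (s + t) < 1\<close> makes the coefficients
  sum to one, so the scaled point lies on the chord.\<close>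

lemma radial_cross:
  assumes c: "c - v = s *\<^sub>R (a - v) + t *\<^sub>R (b - v)" and st: "0 < s" "0 < t" "1 < s + t"
    and ne: "a \<noteq> b" "v \<noteq> c"
  shows "open_segment v c \<inter> open_segment a b \<noteq> {}"
proof -
  define X where "X = v + (1 / (s + t)) *\<^sub>R (c - v)"
  have "X = (1 - 1 / (s + t)) *\<^sub>R v + (1 / (s + t)) *\<^sub>R c" unfolding X_def by (simp add: algebra_simps)
  moreover have "0 < 1 / (s + t)" "1 / (s + t) < 1" using st by (auto simp: field_simps)
  ultimately have 1: "X \<in> open_segment v c" using ne unfolding in_segment(2) by blast
  have s: "1 - t / (s + t) = s / (s + t)" using st by (simp add: field_simps)
  have "X = v + (s / (s + t)) *\<^sub>R (a - v) + (t / (s + t)) *\<^sub>R (b - v)"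
    unfolding X_def c by (simp add: scaleR_right_distrib)
  also have "\<dots> = (1 - s / (s + t) - t / (s + t)) *\<^sub>R v + (s / (s + t)) *\<^sub>R a + (t / (s + t)) *\<^sub>R b"
    by (simp add: algebra_simps)
  also have "1 - s / (s + t) - t / (s + t) = 0" using s by simp
  finally have "X = (1 - t / (s + t)) *\<^sub>R a + (t / (s + t)) *\<^sub>R b" using s by simp
  moreover have "0 < t / (s + t)" "t / (s + t) < 1" using st by (auto simp: field_simps)
  ultimately have "X \<in> open_segment a b" using ne unfolding in_segment(2) by blast
  then show ?thesis using 1 by blast
qed

text \<open>One turn around the center is the shift by \<open>m\<close>, so cyclic order becomes the
  order of the integers; \<open>A\<close> is a lift of the polar angle measured from
  \<open>z\<close>. \<open>A_pi\<close> keeps the center off every chord, and \<open>extreme\<close>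
  expresses convex position.\<close>

locale angular_sequence =
  fixes P :: "int \<Rightarrow> complex" and A \<rho> :: "int \<Rightarrow> real" and m :: int and v z :: complex
  assumes polar: "P a - v = z * (of_real (\<rho> a) * cis (A a))" and \<rho>_pos: "0 < \<rho> a" and z: "z \<noteq> 0"
    and A_mono: "a < b \<Longrightarrow> A a < A b" and A_per: "A (a + m) = A a + 2 * pi" and P_per: "P (a + m) = P a"
    and A_pi: "A b - A a \<noteq> pi"
    and extreme: "P b \<noteq> P a \<Longrightarrow> P b \<noteq> P c \<Longrightarrow> P b \<notin> convex hull {v, P a, P c}"
begin

text \<open>Twice the signed area of the triangle \<open>v\<close>, \<open>P a\<close>,
  \<open>P b\<close>.\<close>

definition area :: "int \<Rightarrow> int \<Rightarrow> real" where
  "area a b = Im (cnj (P a - v) * (P b - v))"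

lemma area_eq: "area a b = (cmod z)\<^sup>2 * \<rho> a * \<rho> b * sin (A b - A a)"
proof -
  have "cnj (P a - v) * (P b - v) = of_real ((cmod z)\<^sup>2 * \<rho> a * \<rho> b) * cis (A b - A a)"
  proof -
    have "cis (A b - A a) = cnj (cis (A a)) * cis (A b)" by (simp add: cis_cnj cis_mult)
    then show ?thesis unfolding polar using complex_norm_square[of z] by simp
  qed
  then show ?thesis unfolding area_def by simp
qed

lemma area_pos: "a < b \<Longrightarrow> A b - A a < pi \<Longrightarrow> 0 < area a b"
  unfolding area_eq using z \<rho>_pos A_mono sin_gt_zero by (intro mult_pos_pos) auto

lemma A_lt: "b < a + m \<Longrightarrow> A b < A a + 2 * pi"
  using A_mono[of b "a + m"] A_per by simp

lemma P_neq: assumes "a < b" "b < a + m" shows "P a \<noteq> P b"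
proof
  assume "P a = P b"
  then have "area a b = area a a" unfolding area_def by simp
  also have "\<dots> = 0" unfolding area_def by (simp, algebra)
  finally have "area a b = 0" .
  then have s: "sin (A b - A a) = 0" unfolding area_eq using z \<rho>_pos[of a] \<rho>_pos[of b] by auto
  have r: "0 < A b - A a" "A b - A a < 2 * pi" using A_mono A_lt assms by force+
  show False
  proof (cases "A b - A a < pi")
    case True then show ?thesis using sin_gt_zero[OF r(1)] s by simp
  next
    case False
    then have "pi < A b - A a" using A_pi[of b a] by simp
    then show ?thesis using sin_lt_zero[of "A b - A a"] r s by simp
  qed
qed

text \<open>Cramer's rule with the areas as determinants; \<open>s + t \<le> 1\<close> would put
  \<open>P b\<close> into the triangle \<open>v\<close>, \<open>P a\<close>,
  \<open>P c\<close>.\<close>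

lemma cone:
  assumes "a < b" "b < c" "c < a + m" "A c - A a < pi"
  obtains s t where "P b - v = s *\<^sub>R (P a - v) + t *\<^sub>R (P c - v)" "0 < s" "0 < t" "1 < s + t"
    "s = area b c / area a c" "t = area a b / area a c"
proof -
  have pos: "0 < area a b" "0 < area b c" "0 < area a c"
    using area_pos assms A_mono[of a b] A_mono[of b c] by force+
  define s t where "s = area b c / area a c" and "t = area a b / area a c"
  have "area a c *\<^sub>R (P b - v) = area b c *\<^sub>R (P a - v) + area a b *\<^sub>R (P c - v)"
    unfolding area_def complex_eq_iff by (simp add: algebra_simps)
  then have "(1 / area a c) *\<^sub>R (area a c *\<^sub>R (P b - v)) = (1 / area a c) *\<^sub>R (area b c *\<^sub>R (P a - v) + area a b *\<^sub>R (P c - v))"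
    by simp
  then have eq: "P b - v = s *\<^sub>R (P a - v) + t *\<^sub>R (P c - v)"
    unfolding s_def t_def using pos by (simp add: scaleR_right_distrib)
  have st: "0 < s" "0 < t" using pos unfolding s_def t_def by auto
  have "1 < s + t"
  proof (rule ccontr)
    assume "\<not> 1 < s + t"
    moreover have "P b = (1 - s - t) *\<^sub>R v + s *\<^sub>R P a + t *\<^sub>R P c" using eq by (simp add: algebra_simps)
    ultimately have "P b \<in> convex hull {v, P a, P c}"
      unfolding convex_hull_3 using st by (intro CollectI exI[of _ "1 - s - t"] exI[of _ s] exI[of _ t]) auto
    moreover have "P b \<noteq> P a" "P b \<noteq> P c" using P_neq[of a b] P_neq[of b c] assms by force+
    ultimately show False using extreme by blast
  qed
  then show ?thesis using that eq st s_def t_def by blast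
qed

lemma orient_area: "orient (P a) (P b) (P c) = area a b + area b c - area a c"
  unfolding orient_def area_def by (simp add: algebra_simps)

lemma orient_pos_narrow:
  assumes "a < b" "b < c" "c < a + m" "A c - A a < pi"
  shows "0 < orient (P a) (P b) (P c)"
proof -
  have ac: "0 < area a c" using area_pos assms by simp
  obtain s t where "1 < s + t" "s = area b c / area a c" "t = area a b / area a c"
    using cone[OF assms] by metis
  then show ?thesis unfolding orient_area using ac by (simp add: field_simps)
qed

text \<open>If the three points fit into an angle below pi, a cyclic rotation leads to the narrow
  case. Otherwise the center is inside the triangle and the three areas around it add up.\<close>

lemma orient_pos:
  assumes "a < b" "b < c" "c < a + m"
  shows "0 < orient (P a) (P b) (P c)"
proof -
  consider "A c - A a < pi" | "A (a + m) - A b < pi" | "A (b + m) - A c < pi"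
    | "pi < A c - A a" "pi < A (a + m) - A b" "pi < A (b + m) - A c"
    using A_pi[of c a] A_pi[of "a + m" b] A_pi[of "b + m" c] by fastforce
  then show ?thesis
  proof cases
    case 1 then show ?thesis using orient_pos_narrow assms by blast
  next
    case 2
    then have "0 < orient (P b) (P c) (P (a + m))" by (intro orient_pos_narrow) (use assms in auto)
    then show ?thesis using P_per orient_rotate[of "P a"] by simp
  next
    case 3
    then have "0 < orient (P c) (P (a + m)) (P (b + m))" by (intro orient_pos_narrow) (use assms in auto)
    then show ?thesis using P_per orient_rotate[of "P a"] orient_rotate[of "P b"] by simp
  next
    case 4
    have "0 < area a b" "0 < area b c" "0 < area c (a + m)"
      by (intro area_pos; use assms 4 A_per in simp)+
    moreover have "area c (a + m) = - area a c" unfolding area_def P_per by (simp, algebra)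
    ultimately show ?thesis unfolding orient_area by simp
  qed
qed

lemma chords_cross:
  assumes "a < c" "c < b" "b < d" "d < a + m"
  shows "open_segment (P a) (P b) \<inter> open_segment (P c) (P d) \<noteq> {}"
  by (rule segments_cross; rule orient_pos; use assms in simp)

lemma radial_chord_cross:
  assumes "a < c" "c < b" "b < a + m" "A b - A a < pi"
  shows "open_segment v (P c) \<inter> open_segment (P a) (P b) \<noteq> {}"
proof -
  obtain s t where st: "P c - v = s *\<^sub>R (P a - v) + t *\<^sub>R (P b - v)" "0 < s" "0 < t" "1 < s + t"
    using cone[OF assms] by metis
  have "P c - v \<noteq> 0" unfolding polar using z \<rho>_pos[of c] by simp
  then show ?thesis using radial_cross[OF st] P_neq[of a b] assms by auto
qed

end

section \<open>Plane trees on the cyclic sequence of hull points\<close>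

text \<open>
  Here \<open>f j\<close> is the index of the first point of group \<open>j\<close>. For a chord between points \<open>a\<close> and \<open>b\<close>
  exactly one of \<open>(a, b)\<close> and \<open>(b, a + m)\<close> is short: the one on the side without the center.
\<close>

definition short_arc :: "(int \<Rightarrow> int) \<Rightarrow> int \<Rightarrow> int \<Rightarrow> int \<Rightarrow> bool" where
  "short_arc f h a b \<longleftrightarrow> a < b \<and> (\<exists>j. f j \<le> a \<and> b < f (j + h + 1))"

section \<open>Arithmetic of the periodic sequence of groups\<close>

locale cyclic_groups =
  fixes f :: "int \<Rightarrow> int" and m n h :: int
  assumes h_pos: "1 \<le> h" and m_eq: "m = 2 * n - 1"
    and f_step: "f j < f (j + 1)"
    and f_per: "f (j + (2 * h + 1)) = f j + m"
    and f_win: "f (j + h) - f j \<le> n - 3"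
begin

lemma f_less_nat: "f j < f (j + 1 + int d)"
proof (induction d)
  case 0 show ?case using f_step[of j] by simp
next
  case (Suc d)
  show ?case using Suc f_step[of "j + 1 + int d"] by (simp add: algebra_simps)
qed

lemma f_less: "i < j \<Longrightarrow> f i < f j"
  using f_less_nat[of i "nat (j - i - 1)"] by simp

lemma f_le: "i \<le> j \<Longrightarrow> f i \<le> f j"
  using f_less[of i j] by (cases "i = j") auto

lemma f_less_iff: "f i < f j \<longleftrightarrow> i < j"
  using f_less[of i j] f_le[of j i] by linarith

lemma m_pos: "0 < m"
  using f_per[of 0] f_less[of 0 "2 * h + 1"] h_pos by simp

lemma f_per_nat: "f (j + int d * (2 * h + 1)) = f j + int d * m"
proof (induction d)
  case (Suc d)
  have "f (j + int (Suc d) * (2 * h + 1)) = f ((j + int d * (2 * h + 1)) + (2 * h + 1))"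
    by (simp add: algebra_simps)
  also have "\<dots> = f (j + int d * (2 * h + 1)) + m" by (rule f_per)
  finally show ?case using Suc by (simp add: algebra_simps)
qed simp

lemma f_perz: "f (j + z * (2 * h + 1)) = f j + z * m"
proof (cases "z \<ge> 0")
  case True
  then show ?thesis using f_per_nat[of j "nat z"] by simp
next
  case False
  then show ?thesis using f_per_nat[of "j + z * (2 * h + 1)" "nat (- z)"] by (simp add: algebra_simps)
qed

lemma short_arc_shift: "short_arc f h a b \<Longrightarrow> short_arc f h (a + z * m) (b + z * m)"
proof -
  assume "short_arc f h a b"
  then obtain j where j: "a < b" "f j \<le> a" "b < f (j + h + 1)" unfolding short_arc_def by auto
  have "f (j + z * (2 * h + 1)) \<le> a + z * m" using j f_perz by simp
  moreover have "b + z * m < f (j + z * (2 * h + 1) + h + 1)"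
    using j f_perz[of "j + h + 1" z] by (simp add: algebra_simps)
  ultimately show ?thesis using j unfolding short_arc_def by auto
qed

text \<open>The other \<open>h\<close> groups have at most \<open>n - 3\<close> of the
  \<open>2 * n - 1\<close> points. So all the lengths up to \<open>n\<close> used in the counts fit
  into every window.\<close>

lemma window_ge: "n + 2 \<le> f (j + h + 1) - f j"
  using f_win[of "j + h + 1"] f_per[of j] m_eq by (simp add: algebra_simps)

lemma group_le: "f (j + 1) - f j \<le> n - 3"
  using f_win[of j] f_le[of "j + 1" "j + h"] h_pos by linarith

lemma window_le: "f (j + h + 1) - f j \<le> 2 * n - 6"
  using f_win[of j] group_le[of "j + h"] by linarith

lemma n_ge: "4 \<le> n"
  using f_win[of 0] f_less[of 0 "0 + h"] h_pos by linarith

lemma shift_into: obtains z where "p \<le> c + z * m" "c + z * m < p + m"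
proof
  show "p \<le> c + (- ((c - p) div m)) * m"
    using pos_mod_sign[OF m_pos, of "c - p"] div_mult_mod_eq[of "c - p" m] by linarith
  show "c + (- ((c - p) div m)) * m < p + m"
    using pos_mod_bound[OF m_pos, of "c - p"] div_mult_mod_eq[of "c - p" m] by linarith
qed

lemma group_of: obtains j where "f j \<le> a" "a < f (j + 1)"
proof -
  obtain z where z: "f 0 \<le> a + z * m" "a + z * m < f 0 + m" by (rule shift_into)
  have 1: "f (- z * (2 * h + 1)) \<le> a" using z f_perz[of 0 "- z"] by simp
  have "f ((2 * h + 1) + - z * (2 * h + 1)) = f (0 + (2 * h + 1)) - z * m"
    using f_perz[of "2 * h + 1" "- z"] by simp
  also have "\<dots> = f 0 + m - z * m" by (subst f_per) simp
  finally have 2: "a < f (- z * (2 * h + 1) + (2 * h + 1))"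
    using z by (simp add: add.commute)
  have ex: "\<exists>j. f j \<le> a \<and> a < f (j + 1)" if "f i \<le> a" "a < f (i + int d)" for i d
    using that
  proof (induction d)
    case (Suc d)
    show ?case
    proof (cases "a < f (i + int d)")
      case True then show ?thesis using Suc by blast
    next
      case False
      then show ?thesis using Suc by (intro exI[of _ "i + int d"]) (simp add: algebra_simps)
    qed
  qed simp
  show ?thesis using ex[of "- z * (2 * h + 1)" "nat (2 * h + 1)"] 1 2 h_pos that by auto
qed

lemma hull_short: "short_arc f h c (c + 1)"
proof -
  obtain j where j: "f j \<le> c" "c < f (j + 1)" by (rule group_of)
  then have "c + 1 < f (j + h + 1)" using f_less[of "j + 1" "j + h + 1"] h_pos by simp
  then show ?thesis using j unfolding short_arc_def by auto
qed

lemma window_short: "f j \<le> a \<Longrightarrow> a < b \<Longrightarrow> b < f (j + h + 1) \<Longrightarrow> short_arc f h a b"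
  unfolding short_arc_def by auto

end

text \<open>
  The colors are the trees of a partition: \<open>col a b\<close> contains the chord and \<open>rc a\<close> the radial edge.
  The assumption \<open>cut\<close> is connectivity, and \<open>card_I\<close> comes from the number of edges of a forest.
\<close>

locale wheel_coloring = cyclic_groups +
  fixes col :: "int \<Rightarrow> int \<Rightarrow> 'c" and rc :: "int \<Rightarrow> 'c" and I :: "'c set"
  assumes fin_I: "finite I" and card_I: "n \<le> int (card I)"
    and col_I: "short_arc f h a b \<Longrightarrow> col a b \<in> I" and rc_I: "rc a \<in> I"
    and col_per1: "col (a + m) (b + m) = col a b" and rc_per1: "rc (a + m) = rc a"
    and noncross: "\<lbrakk>short_arc f h a b; short_arc f h c d; col a b = col c d; a < c; c < b; b < d\<rbrakk> \<Longrightarrow> False"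
    and rad: "\<lbrakk>short_arc f h a b; a < c; c < b\<rbrakk> \<Longrightarrow> rc c \<noteq> col a b"
    and cut: "\<lbrakk>T \<in> I; \<And>x. x + m \<in> S \<longleftrightarrow> x \<in> S; S \<noteq> {}; \<And>x. x \<in> S \<Longrightarrow> rc x \<noteq> T\<rbrakk>
      \<Longrightarrow> \<exists>a b. short_arc f h a b \<and> col a b = T \<and> (a \<in> S) \<noteq> (b \<in> S)"
begin

section \<open>Connectivity and noncrossing for the arcs of one tree\<close>

definition tree_arc :: "'c \<Rightarrow> int \<Rightarrow> int \<Rightarrow> bool" where
  "tree_arc T a b \<longleftrightarrow> short_arc f h a b \<and> col a b = T"

lemma rc_nat: "rc (a + int d * m) = rc a"
proof (induction d)
  case (Suc d)
  show ?case using Suc rc_per1[of "a + int d * m"] by (simp add: algebra_simps)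
qed simp

lemma rc_per: "rc (a + z * m) = rc a"
proof (cases "z \<ge> 0")
  case True
  then show ?thesis using rc_nat[of a "nat z"] by simp
next
  case False
  then show ?thesis using rc_nat[of "a + z * m" "nat (- z)"] by (simp add: algebra_simps)
qed

lemma col_nat: "col (a + int d * m) (b + int d * m) = col a b"
proof (induction d)
  case (Suc d)
  show ?case using Suc col_per1[of "a + int d * m" "b + int d * m"] by (simp add: algebra_simps)
qed simp

lemma col_per: "col (a + z * m) (b + z * m) = col a b"
proof (cases "z \<ge> 0")
  case True
  then show ?thesis using col_nat[of a "nat z" b] by simp
next
  case False
  then show ?thesis using col_nat[of "a + z * m" "nat (- z)" "b + z * m"] by (simp add: algebra_simps)
qed

lemma arc_shift: "tree_arc T a b \<Longrightarrow> tree_arc T (a + z * m) (b + z * m)"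
  unfolding tree_arc_def using short_arc_shift col_per by auto

lemma arc_less: "tree_arc T a b \<Longrightarrow> a < b"
  unfolding tree_arc_def short_arc_def by simp

lemma arc_noncross: "tree_arc T a b \<Longrightarrow> tree_arc T c d \<Longrightarrow> a < c \<Longrightarrow> c < b \<Longrightarrow> d \<le> b"
  unfolding tree_arc_def by (metis noncross not_le)

lemma arc_rad: "tree_arc T a b \<Longrightarrow> a < c \<Longrightarrow> c < b \<Longrightarrow> rc c \<noteq> T"
  using rad unfolding tree_arc_def by auto

lemma arc_eq: "tree_arc T a b \<Longrightarrow> tree_arc T' a b \<Longrightarrow> T = T'"
  unfolding tree_arc_def by auto

lemma arc_I: "tree_arc T a b \<Longrightarrow> T \<in> I"
  unfolding tree_arc_def using col_I by auto

lemma arc_len: assumes "tree_arc T a b" shows "b - a \<le> 2 * n - 7"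
proof -
  obtain j where "f j \<le> a" "b < f (j + h + 1)"
    using assms unfolding tree_arc_def short_arc_def by auto
  then show ?thesis using window_le[of j] by linarith
qed

text \<open>\<open>cut\<close> is applied to the union of all shifts of the interval, because arcs
  live on the line and the tree on the circle. The arc found is moved so that its end inside this
  union lies in the interval itself; its other end avoids all shifts.\<close>

lemma cut_interval:
  assumes "T \<in> I" "c \<le> d" "\<And>x. c \<le> x \<Longrightarrow> x \<le> d \<Longrightarrow> rc x \<noteq> T"
  obtains a b where "tree_arc T a b" "c \<le> a" "a \<le> d" "\<And>z. \<not> (c \<le> b + z * m \<and> b + z * m \<le> d)"
  | a b where "tree_arc T a b" "c \<le> b" "b \<le> d" "\<And>z. \<not> (c \<le> a + z * m \<and> a + z * m \<le> d)"
proof -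
  define S where "S = {x. \<exists>z. c \<le> x + z * m \<and> x + z * m \<le> d}"
  have per: "x + m \<in> S \<longleftrightarrow> x \<in> S" for x
  proof
    assume "x + m \<in> S"
    then obtain z where "c \<le> x + m + z * m \<and> x + m + z * m \<le> d" unfolding S_def by auto
    then show "x \<in> S" unfolding S_def by (intro CollectI exI[of _ "z + 1"]) (simp add: algebra_simps)
  next
    assume "x \<in> S"
    then obtain z where "c \<le> x + z * m \<and> x + z * m \<le> d" unfolding S_def by auto
    then show "x + m \<in> S" unfolding S_def by (intro CollectI exI[of _ "z - 1"]) (simp add: algebra_simps)
  qed
  have ne: "S \<noteq> {}" using assms(2) proof -
    have "c \<in> S" unfolding S_def using assms(2) by (intro CollectI exI[of _ 0]) simp
    then show ?thesis by auto
  qed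
  have nr: "rc x \<noteq> T" if xS: "x \<in> S" for x
  proof -
    obtain z where "c \<le> x + z * m" "x + z * m \<le> d" using xS unfolding S_def by blast
    then show ?thesis using assms(3)[of "x + z * m"] rc_per[of x z] by simp
  qed
  obtain a b where ab: "tree_arc T a b" "(a \<in> S) \<noteq> (b \<in> S)"
    using cut[OF assms(1) per ne nr] unfolding tree_arc_def by auto
  have tr: "\<not> (c \<le> x + z * m + w * m \<and> x + z * m + w * m \<le> d)" if "x \<notin> S" for x z w
  proof -
    have "\<not> (c \<le> x + (z + w) * m \<and> x + (z + w) * m \<le> d)" using that unfolding S_def by blast
    then show ?thesis by (simp add: distrib_right add.assoc)
  qed
  show ?thesis
  proof (cases "a \<in> S")
    case True
    then obtain z where z: "c \<le> a + z * m" "a + z * m \<le> d" unfolding S_def by auto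
    show ?thesis
      by (rule that(1)[OF arc_shift[OF ab(1), of z] z]) (use tr[of b z] True ab(2) in auto)
  next
    case False
    then obtain z where z: "c \<le> b + z * m" "b + z * m \<le> d" using ab(2) unfolding S_def by auto
    show ?thesis
      by (rule that(2)[OF arc_shift[OF ab(1), of z] z]) (use tr[of a z] False in auto)
  qed
qed

lemma arc_inside:
  assumes "tree_arc T a b" "tree_arc T c d" "a < c \<and> c < b \<or> a < d \<and> d < b"
  shows "a \<le> c \<and> d \<le> b"
  using assms arc_noncross[OF assms(1,2)] arc_noncross[OF assms(2,1)] arc_less[OF assms(1)] arc_less[OF assms(2)]
  by linarith

text \<open>The points strictly inside an arc have no radial edge in its tree, so an arc must leave
  them, and noncrossing keeps it below the given one.\<close>

lemma inner_arc:
  assumes "tree_arc T a b" "a + 1 < b"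
  obtains c d where "tree_arc T c d" "a \<le> c" "d \<le> b" "a < c \<or> d < b"
proof -
  have T: "T \<in> I" using assms(1) by (rule arc_I)
  have le: "a + 1 \<le> b - 1" using assms(2) by simp
  have nr: "rc x \<noteq> T" if "a + 1 \<le> x" "x \<le> b - 1" for x
    using arc_rad[OF assms(1), of x] that by simp
  show ?thesis
  proof (rule cut_interval[OF T le nr])
    fix c d
    assume cd: "tree_arc T c d" "a + 1 \<le> c" "c \<le> b - 1" and nz: "\<And>z. \<not> (a + 1 \<le> d + z * m \<and> d + z * m \<le> b - 1)"
    show thesis
      by (rule that[OF cd(1)]) (use arc_inside[OF assms(1) cd(1)] cd in linarith)+
  next
    fix c d
    assume cd: "tree_arc T c d" "a + 1 \<le> d" "d \<le> b - 1" and nz: "\<And>z. \<not> (a + 1 \<le> c + z * m \<and> c + z * m \<le> b - 1)"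
    show thesis
      by (rule that[OF cd(1)]) (use arc_inside[OF assms(1) cd(1)] cd in linarith)+
  qed
qed

text \<open>Descent by \<open>inner_arc\<close> to an arc of length one. This allows hull edges to
  be counted in place of disjoint arcs.\<close>

lemma hull_under: "tree_arc T a b \<Longrightarrow> \<exists>c. a \<le> c \<and> c < b \<and> col c (c + 1) = T"
proof (induction "nat (b - a)" arbitrary: a b rule: less_induct)
  case less
  show ?case
  proof (cases "b = a + 1")
    case True
    then show ?thesis using less(2) unfolding tree_arc_def by auto
  next
    case False
    then have "a + 1 < b" using arc_less[OF less(2)] by simp
    then obtain c d where cd: "tree_arc T c d" "a \<le> c" "d \<le> b" "a < c \<or> d < b"
      by (rule inner_arc[OF less(2)])
    then have "nat (d - c) < nat (b - a)" using arc_less[OF less(2)] by linarith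
    from less(1)[OF this cd(1)] obtain x where "c \<le> x" "x < d" "col x (x + 1) = T" by blast
    then show ?thesis using cd(2,3) by (intro exI[of _ x]) simp
  qed
qed

section \<open>Counting hull edges and radial edges over one period\<close>

definition hulls :: "'c \<Rightarrow> int set" where
  "hulls T = {0..<m} \<inter> {c. col c (c + 1) = T}"

definition rads :: "'c \<Rightarrow> int set" where
  "rads T = {0..<m} \<inter> {c. rc c = T}"

lemma mod_inj: "inj_on (\<lambda>c. c mod m) {p..<p + m}"
proof (rule inj_onI)
  fix x y assume xy: "x \<in> {p..<p + m}" "y \<in> {p..<p + m}" "x mod m = y mod m"
  then have "m dvd x - y" by (simp add: mod_eq_dvd_iff)
  then show "x = y" using xy dvd_imp_le_int[of "x - y" m] by fastforce
qed

lemma mod_as_shift: "c mod m = c + (- (c div m)) * m"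
  by (simp add: minus_div_mult_eq_mod)

text \<open>The indices may come from any period, since reduction modulo \<open>m\<close> is
  injective on it.\<close>

lemma hulls_card: "C \<subseteq> {p..<p + m} \<Longrightarrow> (\<And>c. c \<in> C \<Longrightarrow> col c (c + 1) = T) \<Longrightarrow> card C \<le> card (hulls T)"
proof -
  assume C: "C \<subseteq> {p..<p + m}" "\<And>c. c \<in> C \<Longrightarrow> col c (c + 1) = T"
  have "(\<lambda>c. c mod m) ` C \<subseteq> hulls T"
  proof
    fix x assume "x \<in> (\<lambda>c. c mod m) ` C"
    then obtain c where c: "c \<in> C" "x = c mod m" by auto
    have "x + 1 = c + 1 + (- (c div m)) * m" unfolding c(2) mod_as_shift[of c] by simp
    then have "col x (x + 1) = col c (c + 1)"
      using col_per[of c "- (c div m)" "c + 1"] unfolding c(2) mod_as_shift[of c] by metis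
    then show "x \<in> hulls T" using c C(2) m_pos unfolding hulls_def by auto
  qed
  moreover have "finite (hulls T)" unfolding hulls_def by simp
  ultimately show ?thesis using card_inj_on_le[OF inj_on_subset[OF mod_inj C(1)]] by blast
qed

lemma rads_card: "C \<subseteq> {p..<p + m} \<Longrightarrow> (\<And>c. c \<in> C \<Longrightarrow> rc c = T) \<Longrightarrow> card C \<le> card (rads T)"
proof -
  assume C: "C \<subseteq> {p..<p + m}" "\<And>c. c \<in> C \<Longrightarrow> rc c = T"
  have "(\<lambda>c. c mod m) ` C \<subseteq> rads T"
  proof
    fix x assume "x \<in> (\<lambda>c. c mod m) ` C"
    then obtain c where c: "c \<in> C" "x = c mod m" by auto
    have "rc x = rc c"
      unfolding c(2) mod_as_shift[of c] by (rule rc_per)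
    then show "x \<in> rads T" using c C(2) m_pos unfolding rads_def by auto
  qed
  moreover have "finite (rads T)" unfolding rads_def by simp
  ultimately show ?thesis using card_inj_on_le[OF inj_on_subset[OF mod_inj C(1)]] by blast
qed

lemma hulls_sum: "(\<Sum>T\<in>I. int (card (hulls T))) = m"
proof -
  have "(\<Union>T\<in>I. hulls T) = {0..<m}"
    unfolding hulls_def using col_I[OF hull_short] by auto
  moreover have "card (\<Union>T\<in>I. hulls T) = (\<Sum>T\<in>I. card (hulls T))"
    by (rule card_UN_disjoint) (simp add: fin_I, simp add: hulls_def, auto simp: hulls_def)
  ultimately show ?thesis using m_pos by (simp flip: of_nat_sum)
qed

lemma rads_sum: "(\<Sum>T\<in>I. int (card (rads T))) = m"
proof -
  have "(\<Union>T\<in>I. rads T) = {0..<m}"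
    unfolding rads_def using rc_I by auto
  moreover have "card (\<Union>T\<in>I. rads T) = (\<Sum>T\<in>I. card (rads T))"
    by (rule card_UN_disjoint) (simp add: fin_I, simp add: rads_def, auto simp: rads_def)
  ultimately show ?thesis using m_pos by (simp flip: of_nat_sum)
qed

text \<open>This is \<open>cut\<close> for the set of all points, which no arc can leave.\<close>

lemma ex_rad: assumes "T \<in> I" shows "\<exists>x. rc x = T"
proof (rule ccontr)
  assume "\<not> ?thesis"
  then have "\<exists>a b. short_arc f h a b \<and> col a b = T \<and> (a \<in> (UNIV::int set)) \<noteq> (b \<in> (UNIV::int set))"
    using cut[OF assms, of UNIV] by auto
  then show False by simp
qed

lemma rads_pos: assumes "T \<in> I" shows "1 \<le> card (rads T)"
proof -
  obtain x where "rc x = T" using ex_rad[OF assms] by auto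
  then show ?thesis using rads_card[of "{x}" x T] m_pos by simp
qed

lemma longest_arc:
  assumes "tree_arc T c0 d0" "P c0 d0"
  shows "\<exists>p q. tree_arc T p q \<and> P p q \<and> (\<forall>c d. tree_arc T c d \<longrightarrow> P c d \<longrightarrow> d - c \<le> q - p)"
proof -
  let ?S = "{l. \<exists>c d. tree_arc T c d \<and> P c d \<and> l = d - c}"
  have sub: "?S \<subseteq> {0..2 * n}" using arc_len arc_less by fastforce
  have fin: "finite ?S" by (rule finite_subset[OF sub]) simp
  have ne: "?S \<noteq> {}" using assms by auto
  obtain p q where pq: "tree_arc T p q" "P p q" "Max ?S = q - p" using Max_in[OF fin ne] by auto
  have "d - c \<le> q - p" if "tree_arc T c d" "P c d" for c d
    using Max_ge[OF fin, of "d - c"] that pq by auto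
  then show ?thesis using pq by blast
qed

lemma two_hulls:
  assumes "tree_arc T a b" "tree_arc T c d" "b \<le> c" "d \<le> a + m"
  shows "2 \<le> card (hulls T)"
proof -
  obtain x where x: "a \<le> x" "x < b" "col x (x + 1) = T" using hull_under[OF assms(1)] by auto
  obtain y where y: "c \<le> y" "y < d" "col y (y + 1) = T" using hull_under[OF assms(2)] by auto
  have "card {x, y} \<le> card (hulls T)"
    by (rule hulls_card[of _ a]) (use x y assms arc_less[OF assms(1)] arc_less[OF assms(2)] in auto)
  then show ?thesis using x y assms by simp
qed

text \<open>The zigzag step. As only one hull edge lies below the arc, all smaller arcs of the tree
  below it are nested in a longest one. Every point strictly inside is an end of one of these, so
  the longest omits at most one point at each end, and connectivity rules out that it omits
  both.\<close>

lemma arc_child: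
  assumes ab: "tree_arc T a b" "a + 1 < b"
    and uniq: "\<And>x y. \<lbrakk>a \<le> x; x < y; y < b; col x (x + 1) = T; col y (y + 1) = T\<rbrakk> \<Longrightarrow> False"
  shows "tree_arc T (a + 1) b \<or> tree_arc T a (b - 1)"
proof -
  define P where "P c d \<longleftrightarrow> a \<le> c \<and> d \<le> b \<and> (a < c \<or> d < b)" for c d
  obtain c0 d0 where "tree_arc T c0 d0" "P c0 d0" using inner_arc[OF ab] unfolding P_def by metis
  then obtain c d where cd: "tree_arc T c d" "P c d" and mx: "\<And>c' d'. tree_arc T c' d' \<Longrightarrow> P c' d' \<Longrightarrow> d' - c' \<le> d - c"
    using longest_arc[of T c0 d0 P] by auto
  have sub: "c \<le> c' \<and> d' \<le> d" if th: "tree_arc T c' d'" "P c' d'" for c' d'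
  proof -
    have "\<not> d' \<le> c"
    proof
      assume "d' \<le> c"
      obtain x where x: "c' \<le> x" "x < d'" "col x (x + 1) = T" using hull_under[OF th(1)] by auto
      obtain y where y: "c \<le> y" "y < d" "col y (y + 1) = T" using hull_under[OF cd(1)] by auto
      show False using uniq[of x y] x y th(2) cd(2) \<open>d' \<le> c\<close> unfolding P_def by simp
    qed
    moreover have "\<not> d \<le> c'"
    proof
      assume "d \<le> c'"
      obtain x where x: "c' \<le> x" "x < d'" "col x (x + 1) = T" using hull_under[OF th(1)] by auto
      obtain y where y: "c \<le> y" "y < d" "col y (y + 1) = T" using hull_under[OF cd(1)] by auto
      show False using uniq[of y x] x y th(2) cd(2) \<open>d \<le> c'\<close> unfolding P_def by simp
    qed
    ultimately show ?thesis
      using arc_noncross[OF th(1) cd(1)] arc_noncross[OF cd(1) th(1)] mx[OF th] by linarith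
  qed
  have T: "T \<in> I" using ab(1) by (rule arc_I)
  \<comment> \<open>Cutting off the single point \<open>x\<close> gives an arc that ends at
    \<open>x\<close>.\<close>
  have pt: "c \<le> x \<and> x \<le> d" if x: "a < x" "x < b" for x
  proof -
    have nr: "rc y \<noteq> T" if "x \<le> y" "y \<le> x" for y using that arc_rad[OF ab(1)] x by auto
    show ?thesis
    proof (rule cut_interval[OF T order_refl nr])
      fix c' d' assume *: "tree_arc T c' d'" "x \<le> c'" "c' \<le> x"
      then have "P c' d'" using arc_inside[OF ab(1) *(1)] x unfolding P_def by auto
      then show ?thesis using sub[OF *(1)] * arc_less[OF *(1)] by auto
    next
      fix c' d' assume *: "tree_arc T c' d'" "x \<le> d'" "d' \<le> x"
      then have "P c' d'" using arc_inside[OF ab(1) *(1)] x unfolding P_def by auto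
      then show ?thesis using sub[OF *(1)] * arc_less[OF *(1)] by auto
    qed
  qed
  have ca: "c \<le> a + 1" using pt[of "a + 1"] ab(2) by simp
  have db: "b - 1 \<le> d" using pt[of "b - 1"] ab(2) by simp
  \<comment> \<open>In this case nothing would connect the points strictly inside with the rest of
    the tree.\<close>
  have "\<not> (c = a + 1 \<and> d = b - 1)"
  proof
    assume e: "c = a + 1 \<and> d = b - 1"
    have nr: "rc y \<noteq> T" if "a + 1 \<le> y" "y \<le> b - 1" for y using arc_rad[OF ab(1)] that by auto
    have le: "a + 1 \<le> b - 1" using ab(2) by simp
    show False
    proof (rule cut_interval[OF T le nr])
      fix c' d' assume *: "tree_arc T c' d'" "a + 1 \<le> c'" "c' \<le> b - 1"
        and nz: "\<And>z. \<not> (a + 1 \<le> d' + z * m \<and> d' + z * m \<le> b - 1)"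
      then have "P c' d'" using arc_inside[OF ab(1) *(1)] unfolding P_def by auto
      then show False using sub[OF *(1)] nz[of 0] e arc_less[OF *(1)] * by auto
    next
      fix c' d' assume *: "tree_arc T c' d'" "a + 1 \<le> d'" "d' \<le> b - 1"
        and nz: "\<And>z. \<not> (a + 1 \<le> c' + z * m \<and> c' + z * m \<le> b - 1)"
      then have "P c' d'" using arc_inside[OF ab(1) *(1)] unfolding P_def by auto
      then show False using sub[OF *(1)] nz[of 0] e arc_less[OF *(1)] * by auto
    qed
  qed
  then have "c = a + 1 \<and> d = b \<or> c = a \<and> d = b - 1" using ca db cd(2) unfolding P_def by linarith
  then show ?thesis using cd(1) by auto
qed

section \<open>Trees with one spine and trees with two spines\<close>

lemma lift_longest:
  assumes pq: "tree_arc T p q" "\<And>c d. tree_arc T c d \<Longrightarrow> d - c \<le> q - p" and cd: "tree_arc T c d"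
  obtains z where "p \<le> c + z * m" "d + z * m \<le> q" | z where "q \<le> c + z * m" "d + z * m \<le> p + m"
proof -
  obtain z where z: "p \<le> c + z * m" "c + z * m < p + m" by (rule shift_into)
  have a: "tree_arc T (c + z * m) (d + z * m)" by (rule arc_shift[OF cd])
  have b: "tree_arc T (p + m) (q + m)" using arc_shift[OF pq(1), of 1] by simp
  have l: "d - c \<le> q - p" by (rule pq(2)[OF cd])
  show ?thesis
  proof (cases "c + z * m < q")
    case True
    then have "d + z * m \<le> q" using arc_noncross[OF pq(1) a] z l by (cases "p = c + z * m") auto
    then show ?thesis using z that(1) by blast
  next
    case False
    have "d + z * m \<le> p + m" using arc_noncross[OF a b] z l arc_less[OF pq(1)] by linarith
    then show ?thesis using False that(2)[of z] by simp
  qed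
qed

text \<open>A tree with a single spine is recorded by what it consumes: the spine meets at most
  \<open>h + 1\<close> groups, and the radial edges of the \<open>h\<close> others all belong to the
  tree. In this form two such trees compete for radial edges.\<close>

definition lonely :: "'c \<Rightarrow> bool" where
  "lonely T \<longleftrightarrow> (\<exists>j. \<forall>x. f j \<le> x \<and> x < f (j + h) \<longrightarrow> rc x = T)"

definition twin :: "'c \<Rightarrow> bool" where
  "twin T \<longleftrightarrow> (\<exists>a b c d. tree_arc T a b \<and> tree_arc T c d \<and> b \<le> c \<and> d \<le> a + m)"

lemma twin_hulls: "twin T \<Longrightarrow> 2 \<le> card (hulls T)"
  unfolding twin_def using two_hulls by blast

text \<open>No arc of the tree ends at \<open>x\<close>, so only the radial edge can connect
  it.\<close>

lemma single_spine_rc: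
  assumes T: "T \<in> I" and ins: "\<And>c d. tree_arc T c d \<Longrightarrow> \<exists>z. p \<le> c + z * m \<and> d + z * m \<le> q"
    and x: "q < x" "x < p + m"
  shows "rc x = T"
proof (rule ccontr)
  assume "rc x \<noteq> T"
  then have nr: "rc y \<noteq> T" if "x \<le> y" "y \<le> x" for y using that by auto
  have no: False if "p \<le> x + z * m" "x + z * m \<le> q" for z
  proof (cases "z \<ge> 0")
    case True
    then show ?thesis using that x m_pos mult_nonneg_nonneg[of z m] by linarith
  next
    case False
    then have "z * m \<le> - m" using m_pos mult_right_mono[of z "-1" m] by simp
    then show ?thesis using that x by linarith
  qed
  show False
  proof (rule cut_interval[OF T order_refl nr])
    fix c d assume *: "tree_arc T c d" "x \<le> c" "c \<le> x"
    then show False using ins[OF *(1)] no arc_less[OF *(1)] by force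
  next
    fix c d assume *: "tree_arc T c d" "x \<le> d" "d \<le> x"
    then show False using ins[OF *(1)] no arc_less[OF *(1)] by force
  qed
qed

lemma no_arc_rc: "T \<in> I \<Longrightarrow> (\<And>c d. \<not> tree_arc T c d) \<Longrightarrow> rc x = T"
  by (rule ccontr, rule cut_interval[of T x x]) auto

lemma single_spine_lonely:
  assumes "T \<in> I" "tree_arc T p q" "\<And>c d. tree_arc T c d \<Longrightarrow> \<exists>z. p \<le> c + z * m \<and> d + z * m \<le> q"
  shows "lonely T"
proof -
  obtain j where j: "f j \<le> p" "q < f (j + h + 1)" using assms(2) unfolding tree_arc_def short_arc_def by auto
  have "f (j + h + 1 + h) = f j + m" using f_per[of j] by (simp add: algebra_simps)
  then show ?thesis unfolding lonely_def using single_spine_rc[OF assms(1,3)] j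
    by (intro exI[of _ "j + h + 1"]) auto
qed

lemma not_lonely:
  assumes T: "T \<in> I" "\<not> lonely T"
  shows "\<exists>p q c d. tree_arc T p q \<and> (\<forall>c d. tree_arc T c d \<longrightarrow> d - c \<le> q - p) \<and> tree_arc T c d \<and> q \<le> c \<and> d \<le> p + m"
proof -
  obtain c0 d0 where cd0: "tree_arc T c0 d0" using no_arc_rc[OF T(1)] T(2) unfolding lonely_def by blast
  obtain p q where pq: "tree_arc T p q" and mx: "\<And>c d. tree_arc T c d \<Longrightarrow> d - c \<le> q - p"
    using longest_arc[OF cd0, of "\<lambda>_ _. True"] by auto
  obtain c d where cd: "tree_arc T c d" "\<And>z. \<not> (p \<le> c + z * m \<and> d + z * m \<le> q)"
    using single_spine_lonely[OF T(1) pq] T(2) by blast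
  obtain z where "q \<le> c + z * m" "d + z * m \<le> p + m"
    by (rule lift_longest[OF pq mx cd(1)]) (use cd(2) in auto)
  then show ?thesis using pq mx arc_shift[OF cd(1), of z] by blast
qed

lemma not_lonely_twin: "T \<in> I \<Longrightarrow> \<not> lonely T \<Longrightarrow> twin T"
  using not_lonely[of T] unfolding twin_def by blast

lemma single_hull_spine:
  assumes T: "T \<in> I" "card (hulls T) = 1"
  shows "\<exists>p q. tree_arc T p q \<and> (\<forall>c d. tree_arc T c d \<longrightarrow> (\<exists>z. p \<le> c + z * m \<and> d + z * m \<le> q))"
proof -
  have nt: "\<not> twin T" using twin_hulls T(2) by fastforce
  obtain x where "x \<in> hulls T" using T(2) by fastforce
  then have x: "tree_arc T x (x + 1)" unfolding hulls_def tree_arc_def using hull_short by auto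
  obtain p q where pq: "tree_arc T p q" and mx: "\<And>c d. tree_arc T c d \<Longrightarrow> d - c \<le> q - p"
    using longest_arc[OF x, of "\<lambda>_ _. True"] by auto
  have "\<exists>z. p \<le> c + z * m \<and> d + z * m \<le> q" if cd: "tree_arc T c d" for c d
  proof (rule lift_longest[OF pq mx cd])
    fix z assume "q \<le> c + z * m" "d + z * m \<le> p + m"
    then have "twin T" unfolding twin_def using pq arc_shift[OF cd, of z] by blast
    then show ?thesis using nt by simp
  qed auto
  then show ?thesis using pq by blast
qed

text \<open>Blocks of \<open>h\<close> groups owned by different trees are disjoint, so two of them
  miss only one of the \<open>2 * h + 1\<close> groups and consume at least \<open>n + 2\<close>
  radial edges. At least \<open>n - 2\<close> other trees need one each, which exceeds
  \<open>2 * n - 1\<close>.\<close>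

lemma lonely_unique:
  assumes T: "T \<in> I" "T' \<in> I" "lonely T" "lonely T'"
  shows "T = T'"
proof (rule ccontr)
  assume ne: "T \<noteq> T'"
  obtain j where j: "\<And>x. f j \<le> x \<Longrightarrow> x < f (j + h) \<Longrightarrow> rc x = T" using T(3) unfolding lonely_def by auto
  obtain j0 where j0: "\<And>x. f j0 \<le> x \<Longrightarrow> x < f (j0 + h) \<Longrightarrow> rc x = T'" using T(4) unfolding lonely_def by auto
  \<comment> \<open>Division rounded up: the shifted second block starts in
    \<open>[j, j + 2 * h]\<close>.\<close>
  define z where "z = (j - j0 + 2 * h) div (2 * h + 1)"
  define j' where "j' = j0 + z * (2 * h + 1)"
  have jj: "j \<le> j'" "j' < j + (2 * h + 1)"
  proof -
    have "j - j0 + 2 * h = z * (2 * h + 1) + (j - j0 + 2 * h) mod (2 * h + 1)"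
      unfolding z_def by (simp only: div_mult_mod_eq)
    moreover have "0 \<le> (j - j0 + 2 * h) mod (2 * h + 1)" "(j - j0 + 2 * h) mod (2 * h + 1) < 2 * h + 1"
      using h_pos pos_mod_bound[of "2 * h + 1" "j - j0 + 2 * h"] by auto
    ultimately show "j \<le> j'" "j' < j + (2 * h + 1)" unfolding j'_def by linarith+
  qed
  have j': "rc x = T'" if "f j' \<le> x" "x < f (j' + h)" for x
  proof -
    have "f j' = f j0 + z * m" unfolding j'_def by (rule f_perz)
    moreover have "f (j' + h) = f (j0 + h) + z * m"
      using f_perz[of "j0 + h" z] unfolding j'_def by (simp add: algebra_simps)
    ultimately have "rc (x + (- z) * m) = T'" using j0[of "x + (- z) * m"] that by simp
    then show ?thesis by (simp only: rc_per)
  qed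
  have "j + h \<le> j'"
  proof (rule ccontr)
    assume "\<not> j + h \<le> j'"
    then show False using j[of "f j'"] j'[of "f j'"] jj ne f_le[of j j'] f_less[of j' "j + h"] f_less[of j' "j' + h"] h_pos by auto
  qed
  moreover have "j' + h \<le> j + (2 * h + 1)"
  proof (rule ccontr)
    assume "\<not> ?thesis"
    then have "rc (f (j + (2 * h + 1))) = T'"
      using j' f_le[of j' "j + (2 * h + 1)"] f_less[of "j + (2 * h + 1)" "j' + h"] jj by auto
    then have "rc (f j + m) = T'" by (simp only: f_per)
    then have "rc (f j) = T'" by (simp only: rc_per1)
    then show False using j[of "f j"] f_less[of j "j + h"] h_pos ne by auto
  qed
  ultimately have "j' = j + h \<or> j' = j + h + 1" by linarith
  then have size: "n + 2 \<le> (f (j + h) - f j) + (f (j' + h) - f j')"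
  proof
    assume e: "j' = j + h"
    have "f (j' + h + 1) = f j + m" unfolding e using f_per[of j] by (simp add: algebra_simps)
    then show ?thesis using group_le[of "j' + h"] m_eq unfolding e by linarith
  next
    assume e: "j' = j + h + 1"
    have "f (j' + h) = f j + m" unfolding e using f_per[of j] by (simp add: algebra_simps)
    then show ?thesis using group_le[of "j + h"] m_eq unfolding e by linarith
  qed
  have w: "f (i + h) \<le> f i + m" for i
    using f_le[of "i + h" "i + (2 * h + 1)"] h_pos by (simp add: f_per)
  have c1: "f (j + h) - f j \<le> int (card (rads T))"
    using rads_card[of "{f j..<f (j + h)}" "f j" T] j w[of j] f_le[of j "j + h"] h_pos by auto
  have c2: "f (j' + h) - f j' \<le> int (card (rads T'))"
    using rads_card[of "{f j'..<f (j' + h)}" "f j'" T'] j' w[of j'] f_le[of j' "j' + h"] h_pos by auto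
  have fin: "finite (I - {T} - {T'})" using fin_I by simp
  have "int (card (I - {T} - {T'})) = int (card I) - 2"
    using T(1,2) ne fin_I card_I n_ge by (simp add: of_nat_diff)
  moreover have "int (card (I - {T} - {T'})) * 1 \<le> (\<Sum>S\<in>I - {T} - {T'}. int (card (rads S)))"
    by (rule sum_bounded_below) (use rads_pos in force)
  moreover have "(\<Sum>S\<in>I. int (card (rads S))) = int (card (rads T)) + (int (card (rads T')) + (\<Sum>S\<in>I - {T} - {T'}. int (card (rads S))))"
    using T(1,2) ne fin_I by (subst sum.remove[of I T]; simp; subst sum.remove[of "I - {T}" T']; simp)
  ultimately show False using rads_sum c1 c2 size card_I m_eq by linarith
qed

text \<open>The lower bounds, \<open>1\<close> for \<open>t0\<close> and \<open>2\<close> for every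
  other tree, already add up to \<open>2 * n - 1\<close>, so all of them are attained.\<close>

lemma exceptional_tree:
  obtains t0 where "t0 \<in> I" "\<And>T. T \<in> I \<Longrightarrow> T \<noteq> t0 \<Longrightarrow> \<not> lonely T"
    "card (hulls t0) = 1" "\<And>T. T \<in> I \<Longrightarrow> T \<noteq> t0 \<Longrightarrow> card (hulls T) = 2"
proof -
  have "\<exists>t0\<in>I. lonely t0"
  proof (rule ccontr)
    assume "\<not> ?thesis"
    then have "int (card I) * 2 \<le> (\<Sum>S\<in>I. int (card (hulls S)))"
      by (intro sum_bounded_below) (use twin_hulls not_lonely_twin in force)
    then show False using hulls_sum card_I m_eq by linarith
  qed
  then obtain t0 where t0: "t0 \<in> I" "lonely t0" by auto
  have nl: "\<not> lonely T" if "T \<in> I" "T \<noteq> t0" for T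
    using lonely_unique[OF t0(1) that(1)] t0(2) that(2) by auto
  obtain t where t: "t \<in> I" "t \<noteq> t0"
  proof -
    have "\<not> I \<subseteq> {t0}" using card_I n_ge card_mono[of "{t0}" I] by auto
    then show ?thesis using that by auto
  qed
  \<comment> \<open>A tree without arcs would own all radial edges and leave none to the
    others.\<close>
  have "\<exists>c d. tree_arc t0 c d"
    using no_arc_rc[OF t0(1)] ex_rad[OF t(1)] t(2) by metis
  then obtain x where "col x (x + 1) = t0" using hull_under by blast
  then have h0: "1 \<le> card (hulls t0)" using hulls_card[of "{x}" x t0] m_pos by simp
  have h2: "2 \<le> card (hulls T)" if "T \<in> I - {t0}" for T using nl that twin_hulls not_lonely_twin by simp
  have split: "(\<Sum>S\<in>I. int (card (hulls S))) = int (card (hulls t0)) + (\<Sum>S\<in>I - {t0}. int (card (hulls S)))"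
    using t0(1) fin_I by (subst sum.remove[of I t0]; simp)
  have ci: "int (card (I - {t0})) = int (card I) - 1" using t0(1) fin_I card_I n_ge by (simp add: of_nat_diff)
  have low: "int (card (I - {t0})) * 2 \<le> (\<Sum>S\<in>I - {t0}. int (card (hulls S)))"
    by (rule sum_bounded_below) (use h2 in force)
  have e1: "card (hulls t0) = 1" using split ci low h0 hulls_sum card_I m_eq by linarith
  have e2: "card (hulls T) = 2" if T: "T \<in> I" "T \<noteq> t0" for T
  proof -
    have fin: "finite (I - {t0})" using fin_I by simp
    have "int (card (I - {t0} - {T})) * 2 \<le> (\<Sum>S\<in>I - {t0} - {T}. int (card (hulls S)))"
      by (rule sum_bounded_below) (use h2 in force)
    moreover have "(\<Sum>S\<in>I - {t0}. int (card (hulls S))) = int (card (hulls T)) + (\<Sum>S\<in>I - {t0} - {T}. int (card (hulls S)))"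
      using T fin by (subst sum.remove[of "I - {t0}" T]; simp)
    moreover have "int (card (I - {t0} - {T})) = int (card I) - 2"
      using T t0(1) fin_I card_I n_ge by (simp add: of_nat_diff)
    ultimately show ?thesis using h2[of T] T split hulls_sum card_I m_eq h0 by force
  qed
  show ?thesis using that t0 nl e1 e2 by blast
qed

text \<open>The second spine is a longest arc in the range left free by the first. An arc below
  neither of them would bring a third hull edge.\<close>

lemma two_spines:
  assumes T: "T \<in> I" "\<not> lonely T" "card (hulls T) = 2"
  shows "\<exists>p q x y. tree_arc T p q \<and> tree_arc T x y \<and> q \<le> x \<and> y \<le> p + m \<and>
    (\<forall>c d. tree_arc T c d \<longrightarrow> (\<exists>z. p \<le> c + z * m \<and> d + z * m \<le> q) \<or> (\<exists>z. x \<le> c + z * m \<and> d + z * m \<le> y))"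
proof -
  obtain p q c0 d0 where pq: "tree_arc T p q" and mx: "\<And>c d. tree_arc T c d \<Longrightarrow> d - c \<le> q - p"
    and cd0: "tree_arc T c0 d0" "q \<le> c0" "d0 \<le> p + m" using not_lonely[OF T(1,2)] by auto
  define P where "P c d \<longleftrightarrow> q \<le> c \<and> d \<le> p + m" for c d
  obtain x y where xy: "tree_arc T x y" "P x y" and mx2: "\<And>c d. tree_arc T c d \<Longrightarrow> P c d \<Longrightarrow> d - c \<le> y - x"
    using longest_arc[OF cd0(1), of P] cd0 unfolding P_def by auto
  obtain a where a: "p \<le> a" "a < q" "col a (a + 1) = T" using hull_under[OF pq] by auto
  obtain b where b: "x \<le> b" "b < y" "col b (b + 1) = T" using hull_under[OF xy(1)] by auto
  have "(\<exists>z. p \<le> c + z * m \<and> d + z * m \<le> q) \<or> (\<exists>z. x \<le> c + z * m \<and> d + z * m \<le> y)" if cd: "tree_arc T c d" for c d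
  proof (rule lift_longest[OF pq mx cd])
    fix z assume z: "q \<le> c + z * m" "d + z * m \<le> p + m"
    have A: "tree_arc T (c + z * m) (d + z * m)" by (rule arc_shift[OF cd])
    obtain e where e: "c + z * m \<le> e" "e < d + z * m" "col e (e + 1) = T" using hull_under[OF A] by auto
    have "\<not> (d + z * m \<le> x \<or> y \<le> c + z * m)"
    proof
      assume "d + z * m \<le> x \<or> y \<le> c + z * m"
      then have "e \<noteq> b" using e b by linarith
      moreover have "card {a, b, e} \<le> card (hulls T)"
        by (rule hulls_card[of _ p]) (use a b e z xy(2) in \<open>auto simp: P_def\<close>)
      moreover have "a \<noteq> b" "a \<noteq> e" using a b e z xy(2) unfolding P_def by linarith+
      ultimately show False using T(3) by simp
    qed
    moreover have "P (c + z * m) (d + z * m)" using z unfolding P_def by simp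
    ultimately have "x \<le> c + z * m \<and> d + z * m \<le> y"
      using mx2[OF A] arc_noncross[OF A xy(1)] arc_noncross[OF xy(1) A] by linarith
    then show ?thesis by blast
  qed auto
  then show ?thesis using pq xy unfolding P_def by blast
qed

text \<open>The arc \<open>a b\<close> is below one spine, so one of the two hull edges is spent on
  the other spine and a single one remains for \<open>arc_child\<close>.\<close>

lemma two_spines_child:
  assumes T: "card (hulls T) = 2"
    and sp: "tree_arc T p q" "tree_arc T x y" "q \<le> x" "y \<le> p + m"
      "\<And>c d. tree_arc T c d \<Longrightarrow> (\<exists>z. p \<le> c + z * m \<and> d + z * m \<le> q) \<or> (\<exists>z. x \<le> c + z * m \<and> d + z * m \<le> y)"
    and ab: "tree_arc T a b" "a + 1 < b"
  shows "tree_arc T (a + 1) b \<or> tree_arc T a (b - 1)"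
proof (rule arc_child[OF ab])
  fix u v assume uv: "a \<le> u" "u < v" "v < b" "col u (u + 1) = T" "col v (v + 1) = T"
  have "\<exists>c d. tree_arc T c d \<and> b \<le> c \<and> d \<le> a + m"
    using sp(5)[OF ab(1)]
  proof (elim disjE exE conjE)
    fix z assume z: "p \<le> a + z * m" "b + z * m \<le> q"
    have "tree_arc T (x + (- z) * m) (y + (- z) * m)" by (rule arc_shift[OF sp(2)])
    then show ?thesis using z sp(3,4)
      by (intro exI[of _ "x + (- z) * m"] exI[of _ "y + (- z) * m"]) simp
  next
    fix z assume z: "x \<le> a + z * m" "b + z * m \<le> y"
    have "tree_arc T (p + (1 - z) * m) (q + (1 - z) * m)" by (rule arc_shift[OF sp(1)])
    then show ?thesis using z sp(3,4)
      by (intro exI[of _ "p + (1 - z) * m"] exI[of _ "q + (1 - z) * m"]) (simp add: algebra_simps)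
  qed
  then obtain c d where cd: "tree_arc T c d" "b \<le> c" "d \<le> a + m" by auto
  obtain e where e: "c \<le> e" "e < d" "col e (e + 1) = T" using hull_under[OF cd(1)] by auto
  have "card {u, v, e} \<le> card (hulls T)"
    by (rule hulls_card[of _ a]) (use uv e cd in auto)
  then show False using T uv e cd by auto
qed

lemma single_hull_child:
  assumes T: "card (hulls T) = 1" and ab: "tree_arc T a b" "a + 1 < b"
  shows "tree_arc T (a + 1) b \<or> tree_arc T a (b - 1)"
proof (rule arc_child[OF ab])
  fix u v assume uv: "a \<le> u" "u < v" "v < b" "col u (u + 1) = T" "col v (v + 1) = T"
  have "card {u, v} \<le> card (hulls T)"
    by (rule hulls_card[of _ a]) (use uv arc_len[OF ab(1)] m_eq in auto)
  then show False using T uv by auto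
qed

end

text \<open>
  The exceptional tree \<open>t0\<close> absorbs the radial edges from \<open>f (h + 1) - 1\<close> to \<open>f (2 * h + 1)\<close> with at most
  one exception, at one of the two ends of this range; \<open>t1\<close> is the tree of that exception.
\<close>

locale wheel_core = wheel_coloring +
  fixes t0 t1
  assumes t0_arcs: "tree_arc t0 a b \<Longrightarrow> \<exists>z. f 0 \<le> a + z * m \<and> b + z * m < f (h + 1)"
    and N_rc: "f (h + 1) - 1 \<le> x \<Longrightarrow> x \<le> f (2 * h + 1) \<Longrightarrow> rc x \<in> {t0, t1}"
    and child: "tree_arc T a b \<Longrightarrow> a + 1 < b \<Longrightarrow> tree_arc T (a + 1) b \<or> tree_arc T a (b - 1)"
    and spines: "T \<in> I \<Longrightarrow> T \<noteq> t0 \<Longrightarrow> \<exists>p q x y. tree_arc T p q \<and> tree_arc T x y \<and> q \<le> x \<and> y \<le> p + m \<and>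
    (\<forall>c d. tree_arc T c d \<longrightarrow> (\<exists>z. p \<le> c + z * m \<and> d + z * m \<le> q) \<or> (\<exists>z. x \<le> c + z * m \<and> d + z * m \<le> y))"

text \<open>The groups are renumbered so that the spine of \<open>t0\<close> lies in groups
  \<open>0\<close> to \<open>h\<close>. Outside this spine \<open>t0\<close> owns every radial edge,
  so each of the two rim points can be an exception only as an end of the spine.\<close>

lemma (in wheel_coloring) wheel_core_exists:
  "\<exists>i t0 t1. wheel_core (\<lambda>j. f (i + j)) m n h col rc I t0 t1"
proof -
  obtain t0 where t0: "t0 \<in> I" and nl: "\<And>T. T \<in> I \<Longrightarrow> T \<noteq> t0 \<Longrightarrow> \<not> lonely T"
    and h0: "card (hulls t0) = 1" and h2: "\<And>T. T \<in> I \<Longrightarrow> T \<noteq> t0 \<Longrightarrow> card (hulls T) = 2"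
    by (rule exceptional_tree) blast
  obtain p q where pq: "tree_arc t0 p q" and ins: "\<And>c d. tree_arc t0 c d \<Longrightarrow> \<exists>z. p \<le> c + z * m \<and> d + z * m \<le> q"
    using single_hull_spine[OF t0 h0] by auto
  obtain i where i: "f i \<le> p" "q < f (i + h + 1)" using pq unfolding tree_arc_def short_arc_def by auto
  have out: "rc x = t0" if "q < x" "x < p + m" for x
    by (rule single_spine_rc[OF t0 ins that])
  have le: "p \<le> q" using arc_less[OF pq] by simp
  \<comment> \<open>Otherwise the points from \<open>p\<close> to \<open>q\<close> would be cut off
    from the center. So the two rim points are not both exceptions.\<close>
  have pqr: "rc p = t0 \<or> rc q = t0"
  proof (rule ccontr)
    assume "\<not> ?thesis"
    then have nr: "rc y \<noteq> t0" if "p \<le> y" "y \<le> q" for y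
      using arc_rad[OF pq, of y] that by (cases "y = p"; cases "y = q") auto
    show False
    proof (rule cut_interval[OF t0 le nr])
      fix c d assume *: "tree_arc t0 c d" "p \<le> c" "c \<le> q" "\<And>z. \<not> (p \<le> d + z * m \<and> d + z * m \<le> q)"
      then show False using ins[OF *(1)] arc_less[OF *(1)] by force
    next
      fix c d assume *: "tree_arc t0 c d" "p \<le> d" "d \<le> q" "\<And>z. \<not> (p \<le> c + z * m \<and> c + z * m \<le> q)"
      then show False using ins[OF *(1)] arc_less[OF *(1)] by force
    qed
  qed
  have per: "f (i + (2 * h + 1)) = f i + m" by (rule f_per)
  \<comment> \<open>Without an exception this is \<open>t0\<close> itself.\<close>
  define t1 where "t1 = (if rc (f (i + h + 1) - 1) = t0 then rc (f (i + (2 * h + 1))) else rc (f (i + h + 1) - 1))"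
  have N: "rc x \<in> {t0, t1}" if x: "f (i + h + 1) - 1 \<le> x" "x \<le> f (i + (2 * h + 1))" for x
  proof (cases "q < x \<and> x < p + m")
    case True then show ?thesis using out by auto
  next
    case False
    then consider "x = q" "q = f (i + h + 1) - 1" | "x = f i + m" "p = f i" using x i per by linarith
    then show ?thesis
    proof cases
      case 1
      then show ?thesis unfolding t1_def by auto
    next
      case 2
      show ?thesis
      proof (cases "rc (f (i + h + 1) - 1) = t0")
        case True
        then show ?thesis using 2 per unfolding t1_def by simp
      next
        case False
        have "f (i + h + 1) - 1 < p + m" using f_less[of "i + h + 1" "i + (2 * h + 1)"] h_pos 2 per by simp
        then have "\<not> q < f (i + h + 1) - 1" using out False by blast
        then have "q = f (i + h + 1) - 1" using i by linarith
        then have "rc p = t0" using pqr False by simp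
        then show ?thesis using 2 rc_per1 by simp
      qed
    qed
  qed
  have sa: "short_arc (\<lambda>j. f (i + j)) h = short_arc f h"
  proof (intro ext)
    fix a b
    show "short_arc (\<lambda>j. f (i + j)) h a b = short_arc f h a b"
      unfolding short_arc_def
      by (auto simp: add.assoc) (metis add.assoc add.commute diff_add_cancel)
  qed
  interpret S: wheel_coloring "\<lambda>j. f (i + j)" m n h col rc I
  proof
    show "f (i + j) < f (i + (j + 1))" for j using f_step[of "i + j"] by (simp add: add.assoc)
    show "f (i + (j + (2 * h + 1))) = f (i + j) + m" for j using f_per[of "i + j"] by (simp add: add.assoc)
    show "f (i + (j + h)) - f (i + j) \<le> n - 3" for j using f_win[of "i + j"] by (simp add: add.assoc)
    show "\<exists>a b. short_arc (\<lambda>j. f (i + j)) h a b \<and> col a b = T \<and> (a \<in> S) \<noteq> (b \<in> S)"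
      if "T \<in> I" "\<And>x. (x + m \<in> S) = (x \<in> S)" "S \<noteq> {}" "\<And>x. x \<in> S \<Longrightarrow> rc x \<noteq> T" for T S
      unfolding sa using cut[OF that] .
  qed (use h_pos m_eq fin_I card_I col_I rc_I col_per1 rc_per1 noncross rad in \<open>auto simp: sa\<close>)
  have Sarc: "S.tree_arc = tree_arc" unfolding S.tree_arc_def tree_arc_def sa ..
  have "wheel_core (\<lambda>j. f (i + j)) m n h col rc I t0 t1"
  proof
    show "\<exists>z. f (i + 0) \<le> a + z * m \<and> b + z * m < f (i + (h + 1))" if ab: "S.tree_arc t0 a b" for a b
    proof -
      obtain z where "p \<le> a + z * m \<and> b + z * m \<le> q" using ins ab unfolding Sarc by auto
      then show ?thesis using i by (intro exI[of _ z]) (simp add: add.assoc)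
    qed
    show "rc x \<in> {t0, t1}" if "f (i + (h + 1)) - 1 \<le> x" "x \<le> f (i + (2 * h + 1))" for x
      by (rule N) (use that in \<open>simp_all add: add.assoc\<close>)
    show "S.tree_arc T (a + 1) b \<or> S.tree_arc T a (b - 1)" if ab: "S.tree_arc T a b" "a + 1 < b" for T a b
    proof (cases "T = t0")
      case True
      then show ?thesis using single_hull_child[OF h0] ab unfolding Sarc by auto
    next
      case False
      have T: "T \<in> I" using ab(1) unfolding Sarc by (rule arc_I)
      show ?thesis using two_spines[OF T nl[OF T False] h2[OF T False]] two_spines_child[OF h2[OF T False]] ab
        unfolding Sarc by blast
    qed
    show "\<exists>p q x y. S.tree_arc T p q \<and> S.tree_arc T x y \<and> q \<le> x \<and> y \<le> p + m \<and>
       (\<forall>c d. S.tree_arc T c d \<longrightarrow> (\<exists>z. p \<le> c + z * m \<and> d + z * m \<le> q) \<or> (\<exists>z. x \<le> c + z * m \<and> d + z * m \<le> y))"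
      if T: "T \<in> I" "T \<noteq> t0" for T
      unfolding Sarc by (rule two_spines[OF T(1) nl[OF T] h2[OF T]])
  qed
  then show ?thesis by blast
qed

section \<open>The counting contradiction\<close>

context wheel_core
begin

section \<open>The two gaps between the spines of a tree\<close>

definition spine :: "'a \<Rightarrow> int \<Rightarrow> int \<Rightarrow> bool" where
  "spine T a b \<longleftrightarrow> tree_arc T a b \<and> (\<forall>c d. tree_arc T c d \<longrightarrow> c \<le> a \<longrightarrow> b \<le> d \<longrightarrow> c = a \<and> d = b)"

text \<open>The two spines of a tree, viewed from the gap between the end \<open>y\<close> of one and the start \<open>v\<close> of the other.\<close>

definition junction :: "'a \<Rightarrow> int \<Rightarrow> int \<Rightarrow> int \<Rightarrow> int \<Rightarrow> bool" where
  "junction T u y v w \<longleftrightarrow> tree_arc T u y \<and> tree_arc T v w \<and> y \<le> v \<and> w \<le> u + m \<and>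
    (\<forall>c d. tree_arc T c d \<longrightarrow> (\<exists>z. u \<le> c + z * m \<and> d + z * m \<le> y) \<or> (\<exists>z. v \<le> c + z * m \<and> d + z * m \<le> w))"

lemma shift_cases: "z * m \<le> - m \<or> z * m = 0 \<or> m \<le> z * m"
proof -
  consider "z \<le> -1" | "z = 0" | "1 \<le> z" by linarith
  then show ?thesis
    using m_pos mult_right_mono[of z "-1" m] mult_right_mono[of 1 z m] by cases auto
qed

lemma junction_arc:
  assumes "junction T u y v w" "tree_arc T c d"
  obtains z where "u \<le> c + z * m" "d + z * m \<le> y" | z where "v \<le> c + z * m" "d + z * m \<le> w"
  using assms unfolding junction_def by blast

lemma junction_shift: "junction T u y v w \<Longrightarrow> junction T (u + z * m) (y + z * m) (v + z * m) (w + z * m)"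
proof -
  assume J: "junction T u y v w"
  have "(\<exists>x. u + z * m \<le> c + x * m \<and> d + x * m \<le> y + z * m) \<or> (\<exists>x. v + z * m \<le> c + x * m \<and> d + x * m \<le> w + z * m)"
    if cd: "tree_arc T c d" for c d
  proof (rule junction_arc[OF J cd])
    fix x assume "u \<le> c + x * m" "d + x * m \<le> y"
    then have "u + z * m \<le> c + (x + z) * m \<and> d + (x + z) * m \<le> y + z * m" by (simp add: distrib_right)
    then show ?thesis by blast
  next
    fix x assume "v \<le> c + x * m" "d + x * m \<le> w"
    then have "v + z * m \<le> c + (x + z) * m \<and> d + (x + z) * m \<le> w + z * m" by (simp add: distrib_right)
    then show ?thesis by blast
  qed
  then show ?thesis using J arc_shift[of T] unfolding junction_def by auto
qed

text \<open>The same two spines, seen from their other gap.\<close>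

lemma junction_swap: "junction T u y v w \<Longrightarrow> junction T v w (u + m) (y + m)"
proof -
  assume J: "junction T u y v w"
  have "(\<exists>x. v \<le> c + x * m \<and> d + x * m \<le> w) \<or> (\<exists>x. u + m \<le> c + x * m \<and> d + x * m \<le> y + m)"
    if cd: "tree_arc T c d" for c d
  proof (rule junction_arc[OF J cd])
    fix x assume "u \<le> c + x * m" "d + x * m \<le> y"
    then have "u + m \<le> c + (x + 1) * m \<and> d + (x + 1) * m \<le> y + m" by (simp add: distrib_right)
    then show ?thesis by blast
  qed blast
  then show ?thesis using J arc_shift[of T _ _ 1] unfolding junction_def by auto
qed

lemma junction_rc:
  assumes J: "junction T u y v w" and x: "y < x" "x < v"
  shows "rc x = T"
proof (rule ccontr)
  assume "rc x \<noteq> T"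
  then have nr: "rc e \<noteq> T" if "x \<le> e" "e \<le> x" for e using that by auto
  have T: "T \<in> I" using J arc_I unfolding junction_def by blast
  have b: "u < y" "v < w" "w \<le> u + m" using J arc_less unfolding junction_def by auto
  have n1: False if "u \<le> x + z * m" "x + z * m \<le> y" for z
    using shift_cases[of z] that x b m_pos by linarith
  have n2: False if "v \<le> x + z * m" "x + z * m \<le> w" for z
    using shift_cases[of z] that x b m_pos by linarith
  show False
  proof (rule cut_interval[OF T order_refl nr])
    fix c d assume *: "tree_arc T c d" "x \<le> c" "c \<le> x"
    then have [simp]: "c = x" by simp
    show False by (rule junction_arc[OF J *(1)]) (use n1 n2 arc_less[OF *(1)] in force)+
  next
    fix c d assume *: "tree_arc T c d" "x \<le> d" "d \<le> x"
    then have [simp]: "d = x" by simp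
    show False by (rule junction_arc[OF J *(1)]) (use n1 n2 arc_less[OF *(1)] in force)+
  qed
qed

text \<open>With both gaps open the spines share no end, so the points of the first reach the center
  only by a radial edge of their own, and there is none strictly inside the spine.\<close>

lemma junction_end_rc:
  assumes J: "junction T u y v w" and g: "y < v" "w < u + m"
  shows "rc u = T \<or> rc y = T"
proof (rule ccontr)
  assume nr0: "\<not> ?thesis"
  have T: "T \<in> I" and uy: "tree_arc T u y" using J arc_I unfolding junction_def by blast+
  have b: "u < y" "v < w" using J arc_less unfolding junction_def by auto
  have nr: "rc e \<noteq> T" if "u \<le> e" "e \<le> y" for e
    using arc_rad[OF uy, of e] nr0 that by (cases "e = u"; cases "e = y") auto
  have le: "u \<le> y" using b by simp
  have n2: False if "v \<le> x + z * m" "x + z * m \<le> w" "u \<le> x" "x \<le> y" for x z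
    using shift_cases[of z] that g b m_pos by linarith
  show False
  proof (rule cut_interval[OF T le nr])
    fix c d assume *: "tree_arc T c d" "u \<le> c" "c \<le> y" "\<And>z. \<not> (u \<le> d + z * m \<and> d + z * m \<le> y)"
    show False by (rule junction_arc[OF J *(1)]) (use * n2[of c] arc_less[OF *(1)] in force)+
  next
    fix c d assume *: "tree_arc T c d" "u \<le> d" "d \<le> y" "\<And>z. \<not> (u \<le> c + z * m \<and> c + z * m \<le> y)"
    show False by (rule junction_arc[OF J *(1)]) (use * n2[of d] arc_less[OF *(1)] in force)+
  qed
qed

lemma junction_spine:
  assumes J: "junction T u y v w"
  shows "spine T u y"
proof -
  have b: "u < y" "v < w" "y \<le> v" "w \<le> u + m" "tree_arc T u y" using J arc_less unfolding junction_def by auto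
  have "c = u \<and> d = y" if cd: "tree_arc T c d" "c \<le> u" "y \<le> d" for c d
  proof (rule junction_arc[OF J cd(1)])
    fix z assume z: "u \<le> c + z * m" "d + z * m \<le> y"
    show ?thesis using shift_cases[of z] z cd(2,3) b(1-4) m_pos by (intro conjI; linarith)
  next
    fix z assume z: "v \<le> c + z * m" "d + z * m \<le> w"
    show ?thesis using shift_cases[of z] z cd(2,3) b(1-4) m_pos by (intro conjI; linarith)
  qed
  then show ?thesis using b unfolding spine_def by blast
qed

lemma f0_m: "f (2 * h + 1) = f 0 + m" using f_per[of 0] by simp

lemma fh_m: "f (h + 1) = f (- h) + m" using f_per[of "- h"] by simp

text \<open>The tree has a radial edge, which must lie in one of its two gaps. It has none from
  \<open>f (h + 1) - 1\<close> to \<open>f (2 * h + 1)\<close>, and a gap cannot extend beyond a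
  point without radial edge, so this gap is confined to groups \<open>0\<close> to
  \<open>h\<close>.\<close>

lemma inner_junction:
  assumes T: "T \<in> I" "T \<noteq> t0" "T \<noteq> t1"
  obtains u y v w r where "junction T u y v w" "y \<le> r" "r \<le> v" "rc r = T" "f 0 \<le> y" "v < f (h + 1)"
proof -
  have nN: "rc x \<noteq> T" if "f (h + 1) - 1 \<le> x" "x \<le> f (2 * h + 1)" for x
    using N_rc[OF that] T by auto
  obtain p q x y where pq: "tree_arc T p q" "tree_arc T x y" "q \<le> x" "y \<le> p + m"
    and al: "\<And>c d. tree_arc T c d \<Longrightarrow> (\<exists>z. p \<le> c + z * m \<and> d + z * m \<le> q) \<or> (\<exists>z. x \<le> c + z * m \<and> d + z * m \<le> y)"
    using spines[OF T(1,2)] by auto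
  have J: "junction T p q x y" unfolding junction_def using pq al by blast
  obtain r0 where r0: "rc r0 = T" using ex_rad[OF T(1)] by auto
  obtain z where z: "p \<le> r0 + z * m" "r0 + z * m < p + m" by (rule shift_into)
  have rz: "rc (r0 + z * m) = T" using r0 rc_per by simp
  have lt: "p < q" "x < y" using pq arc_less by auto
  have "\<exists>u y v w r. junction T u y v w \<and> y \<le> r \<and> r \<le> v \<and> rc r = T"
  proof -
    consider "r0 + z * m = p" | "q \<le> r0 + z * m" "r0 + z * m \<le> x" | "y \<le> r0 + z * m"
      using arc_rad[OF pq(1), of "r0 + z * m"] arc_rad[OF pq(2), of "r0 + z * m"] rz z by linarith
    then show ?thesis
    proof cases
      case 1
      then have "rc (p + m) = T" using rz rc_per1 by simp
      then show ?thesis using junction_swap[OF J] pq by blast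
    next
      case 2 then show ?thesis using J rz by blast
    next
      case 3 then show ?thesis using junction_swap[OF J] rz z by (intro exI[of _ x] exI[of _ y] exI[of _ "p + m"] exI[of _ "q + m"] exI[of _ "r0 + z * m"]) simp
    qed
  qed
  then obtain u' y' v' w' r' where J': "junction T u' y' v' w'" "y' \<le> r'" "r' \<le> v'" "rc r' = T" by auto
  obtain s where s: "f 0 \<le> r' + s * m" "r' + s * m < f 0 + m" by (rule shift_into)
  let ?r = "r' + s * m"
  have J2: "junction T (u' + s * m) (y' + s * m) (v' + s * m) (w' + s * m)" by (rule junction_shift[OF J'(1)])
  have r: "rc ?r = T" using J' rc_per by simp
  have f0: "rc (f 0) \<noteq> T" using nN[of "f (2 * h + 1)"] f0_m rc_per1[of "f 0"] f_less[of "h + 1" "2 * h + 1"] h_pos by simp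
  have fh: "rc (f (h + 1) - 1) \<noteq> T" using nN[of "f (h + 1) - 1"] f_less[of "h + 1" "2 * h + 1"] h_pos by simp
  have r1: "f 0 < ?r" using s r f0 by (cases "?r = f 0") auto
  have r2: "?r < f (h + 1) - 1" using nN[of ?r] r s f0_m by linarith
  have "f 0 \<le> y' + s * m"
    using junction_rc[OF J2, of "f 0"] f0 r1 J'(3) by fastforce
  moreover have "v' + s * m < f (h + 1)"
    using junction_rc[OF J2, of "f (h + 1) - 1"] fh r2 J'(2) by fastforce
  ultimately show ?thesis using J2 J'(2,3) r by (intro that[of "u' + s * m" "y' + s * m" "v' + s * m" "w' + s * m" ?r]) auto
qed

text \<open>The windows of the two spines leave the boundary between groups \<open>g + h\<close> and
  \<open>g + h + 1\<close> to the far gap. The tree owns neither radial edge there, so no point of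
  the boundary is strictly inside that gap, which fixes \<open>u\<close> and \<open>w\<close>. Since
  the spines are separated there, each needs a radial edge at its near end.\<close>

lemma same_group_junction:
  assumes J: "junction T u y v w" and r: "y \<le> r" "r \<le> v" "rc r = T"
    and T: "T \<noteq> t0" "T \<noteq> t1" and g: "0 \<le> g" "g \<le> h" "f g \<le> y" "v < f (g + 1)"
  shows "u = f (g - h)" "w = f (g + h + 1) - 1" "rc y = T" "rc v = T"
proof -
  have nN: "rc x \<noteq> T" if "f (h + 1) - 1 \<le> x" "x \<le> f (2 * h + 1)" for x
    using N_rc[OF that] T by auto
  have arcs: "tree_arc T u y" "tree_arc T v w" "w \<le> u + m" "y \<le> v" using J unfolding junction_def by auto
  obtain j where j: "f j \<le> v" "w < f (j + h + 1)" using arcs unfolding tree_arc_def short_arc_def by auto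
  have "f j < f (g + 1)" using j g by linarith
  then have "j \<le> g" by (simp add: f_less_iff)
  then have w: "w < f (g + h + 1)" using j f_le[of "j + h + 1" "g + h + 1"] by simp
  obtain i where i: "f i \<le> u" "y < f (i + h + 1)" using arcs unfolding tree_arc_def short_arc_def by auto
  have "f g < f (i + h + 1)" using i g by linarith
  then have "g - h \<le> i" by (simp add: f_less_iff)
  then have u: "f (g - h) \<le> u" using i f_le[of "g - h" i] by simp
  have per: "f (g + h + 1) = f (g - h) + m" using f_per[of "g - h"] by (simp add: algebra_simps)
  have lo: "f (h + 1) \<le> f (g + h + 1)" and hi: "f (g + h + 1) \<le> f (2 * h + 1)"
    using f_le[of "h + 1" "g + h + 1"] f_le[of "g + h + 1" "2 * h + 1"] g by auto
  have n1: "rc (f (g + h + 1)) \<noteq> T" and n2: "rc (f (g + h + 1) - 1) \<noteq> T"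
    using nN lo hi by auto
  have J2: "junction T v w (u + m) (y + m)" by (rule junction_swap[OF J])
  show w': "w = f (g + h + 1) - 1"
    using junction_rc[OF J2, of "f (g + h + 1) - 1"] n2 u per w by force
  show u': "u = f (g - h)"
    using junction_rc[OF J2, of "f (g + h + 1)"] n1 u per w by force
  have wu: "w < u + m" using w' u' per by simp
  have ru: "rc u \<noteq> T" using n1 unfolding u' per rc_per1 .
  show "rc y = T"
  proof (cases "y = v")
    case True then show ?thesis using r by simp
  next
    case False
    then show ?thesis using junction_end_rc[OF J _ wu] arcs ru by simp
  qed
  show "rc v = T"
  proof (cases "y = v")
    case True then show ?thesis using r by simp
  next
    case False
    then show ?thesis using junction_end_rc[OF J2 wu] arcs n2 w' by simp
  qed
qed

section \<open>Gaps and long arcs at a boundary between groups\<close>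

lemma cross_junction_rc:
  assumes J: "junction T u y v w" and r: "y \<le> r" "r \<le> v" "rc r = T" and x: "y < x" "x \<le> v"
  shows "rc (x - 1) = T \<or> rc x = T"
proof (cases "x < v")
  case True
  then show ?thesis using junction_rc[OF J, of x] x by simp
next
  case False
  show ?thesis
  proof (cases "y < x - 1")
    case True
    then show ?thesis using junction_rc[OF J, of "x - 1"] x by simp
  next
    case False
    \<comment> \<open>The gap consists of two adjacent points with nothing strictly between, and
      only the witness \<open>r\<close> helps.\<close>
    then have "r = x - 1 \<or> r = x" using r x \<open>\<not> x < v\<close> by linarith
    then show ?thesis using r by auto
  qed
qed

text \<open>A window containing the arc must start no later than group \<open>j\<close> and end no
  earlier than group \<open>j + h\<close>, which leaves one choice.\<close>

lemma long_arc_window: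
  assumes "tree_arc T s e" "s \<le> c" "d \<le> e" "c < f (j + 1)" "f (j + h) \<le> d"
  shows "f j \<le> s" "e < f (j + h + 1)"
proof -
  obtain i where i: "f i \<le> s" "e < f (i + h + 1)" using assms(1) unfolding tree_arc_def short_arc_def by auto
  have "f i < f (j + 1)" "f (j + h) < f (i + h + 1)" using assms i by linarith+
  then have "i = j" by (simp add: f_less_iff)
  then show "f j \<le> s" "e < f (j + h + 1)" using i by auto
qed

text \<open>The arc is too long for \<open>h\<close> groups, so it runs from group \<open>t\<close>
  to group \<open>t + h\<close>, and the spine above it is the one starting at the right end
  \<open>v\<close> of the inner gap. Either this gap stays in group \<open>t\<close> and
  \<open>same_group_junction\<close> gives the spine ending at \<open>y\<close>, or it crosses the
  boundary and a point there is radial.\<close>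

lemma right_boundary_arc:
  assumes T: "T \<in> I" "T \<noteq> t0" "T \<noteq> t1" and t: "1 \<le> t" "t \<le> h"
    and cd: "tree_arc T c d" "f t \<le> c" "d < f (t + h + 1)" "n - 1 \<le> d - c"
  shows "rc (f t - 1) = T \<or> rc (f t) = T \<or> (\<exists>y. f t \<le> y \<and> y \<le> c \<and> rc y = T \<and> spine T (f (t - h)) y)"
proof -
  obtain u y v w r where J: "junction T u y v w" and r: "y \<le> r" "r \<le> v" "rc r = T"
    and b: "f 0 \<le> y" "v < f (h + 1)" by (rule inner_junction[OF T])
  have arcs: "tree_arc T u y" "tree_arc T v w" "w \<le> u + m" "y \<le> v" using J unfolding junction_def by auto
  have c: "c < f (t + 1)" using cd f_win[of "t + 1"] by (simp add: algebra_simps)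
  have d: "f (t + h) \<le> d" using cd f_win[of t] by linarith
  have o: "f (h + 1) \<le> f (t + h)" "f (t + h + 1) \<le> f (2 * h + 1)" "f (t + 1) \<le> f (2 * h + 1)" "f (- h) < f t"
    using t f_le f_less by auto
  have v: "f t \<le> v \<and> v \<le> c"
  proof (rule junction_arc[OF J cd(1)])
    fix z assume z: "u \<le> c + z * m" "d + z * m \<le> y"
    have A: "tree_arc T (u + (- z) * m) (y + (- z) * m)" by (rule arc_shift[OF arcs(1)])
    have e: "y + (- z) * m < f (t + h + 1)" by (rule long_arc_window(2)[OF A, of c d]) (use z c d in auto)
    show ?thesis using shift_cases[of "- z"] e z b o d f0_m arcs(4) m_pos by (intro conjI; linarith)
  next
    fix z assume z: "v \<le> c + z * m" "d + z * m \<le> w"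
    have A: "tree_arc T (v + (- z) * m) (w + (- z) * m)" by (rule arc_shift[OF arcs(2)])
    have e: "f t \<le> v + (- z) * m" by (rule long_arc_window(1)[OF A, of c d]) (use z c d in auto)
    show ?thesis using shift_cases[of "- z"] e z b o c f0_m fh_m arcs(4) m_pos by (intro conjI; linarith)
  qed
  show ?thesis
  proof (cases "f t \<le> y")
    case True
    then show ?thesis
      using same_group_junction[OF J r T(2,3), of t] junction_spine[OF J] v c t arcs(4) by force
  next
    case False
    then show ?thesis using cross_junction_rc[OF J r, of "f t"] v by auto
  qed
qed

text \<open>Mirror image of \<open>right_boundary_arc\<close>, for arcs ending left of the
  boundary.\<close>

lemma left_boundary_arc:
  assumes T: "T \<in> I" "T \<noteq> t0" "T \<noteq> t1" and t: "1 \<le> t" "t \<le> h"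
    and cd: "tree_arc T c d" "f (t - 1 - h) \<le> c" "d < f t" "n - 1 \<le> d - c"
  shows "rc (f t - 1) = T \<or> rc (f t) = T \<or> (\<exists>v. d \<le> v \<and> v < f t \<and> rc v = T \<and> spine T v (f (t + h) - 1))"
proof -
  obtain u y v w r where J: "junction T u y v w" and r: "y \<le> r" "r \<le> v" "rc r = T"
    and b: "f 0 \<le> y" "v < f (h + 1)" by (rule inner_junction[OF T])
  have arcs: "tree_arc T u y" "tree_arc T v w" "w \<le> u + m" "y \<le> v" using J unfolding junction_def by auto
  have c: "c < f (t - 1 - h + 1)" using cd f_win[of "t - h"] by (simp add: algebra_simps)
  have d: "f (t - 1) \<le> d" using cd f_win[of "t - 1 - h"] by simp
  have ft: "f (t - 1 - h + h + 1) = f t" by simp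
  have o: "f (t - 1 - h + 1) \<le> f 0" "f (- h) \<le> f (t - 1 - h)" "f t \<le> f (2 * h + 1)" "f (- h) < f (t - 1)"
    using t f_le f_less by auto
  have y: "d \<le> y \<and> y < f t"
  proof (rule junction_arc[OF J cd(1)])
    fix z assume z: "u \<le> c + z * m" "d + z * m \<le> y"
    have A: "tree_arc T (u + (- z) * m) (y + (- z) * m)" by (rule arc_shift[OF arcs(1)])
    have e: "y + (- z) * m < f t" using long_arc_window(2)[OF A, of c d "t - 1 - h"] z c d ft by auto
    show ?thesis using shift_cases[of "- z"] e z b o d f0_m fh_m arcs(4) m_pos by (intro conjI; linarith)
  next
    fix z assume z: "v \<le> c + z * m" "d + z * m \<le> w"
    have A: "tree_arc T (v + (- z) * m) (w + (- z) * m)" by (rule arc_shift[OF arcs(2)])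
    have e: "f (t - 1 - h) \<le> v + (- z) * m" by (rule long_arc_window(1)[OF A, of c d]) (use z c d in auto)
    show ?thesis using shift_cases[of "- z"] e z b o c f0_m fh_m arcs(4) m_pos by (intro conjI; linarith)
  qed
  have yt: "f (t - 1) \<le> y" using y d by simp
  show ?thesis
  proof (cases "v < f t")
    case True
    have G: "w = f (t + h) - 1" "rc v = T"
      using same_group_junction[OF J r T(2,3), of "t - 1"] True yt t by (auto simp: algebra_simps)
    have "spine T v w" using junction_spine[OF junction_swap[OF J]] .
    then show ?thesis using G True y arcs(4) by force
  next
    case False
    then show ?thesis using cross_junction_rc[OF J r, of "f t"] y by auto
  qed
qed

lemma t0_not_right: "1 \<le> t \<Longrightarrow> t \<le> h \<Longrightarrow> f t \<le> c \<Longrightarrow> c < f (t + 1) \<Longrightarrow> f (t + h) \<le> d \<Longrightarrow> \<not> tree_arc t0 c d"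
proof
  assume a: "1 \<le> t" "t \<le> h" "f t \<le> c" "c < f (t + 1)" "f (t + h) \<le> d" "tree_arc t0 c d"
  obtain z where z: "f 0 \<le> c + z * m" "d + z * m < f (h + 1)" using t0_arcs[OF a(6)] by auto
  have "f (h + 1) \<le> f (t + h)" "f (t + 1) \<le> f (h + 1)" "f (- h) < f 0" using a h_pos f_le f_less by auto
  then show False using shift_cases[of z] z a(3-5) fh_m m_pos by linarith
qed

lemma t0_not_left: "1 \<le> t \<Longrightarrow> t \<le> h \<Longrightarrow> c < f (t - h) \<Longrightarrow> f (t - 1) \<le> d \<Longrightarrow> \<not> tree_arc t0 c d"
proof
  assume a: "1 \<le> t" "t \<le> h" "c < f (t - h)" "f (t - 1) \<le> d" "tree_arc t0 c d"
  obtain z where z: "f 0 \<le> c + z * m" "d + z * m < f (h + 1)" using t0_arcs[OF a(5)] by auto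
  have "f (t - h) \<le> f 0" "f 0 \<le> f (t - 1)" "f (h + 1) \<le> f (2 * h + 1)" using a h_pos f_le by auto
  then show False using shift_cases[of z] z a(3-4) f0_m m_pos by linarith
qed

text \<open>A window has at most \<open>2 * n - 6\<close> points, so two different translates of
  length at least \<open>n - 2\<close> in it cross.\<close>

lemma parallel_arcs:
  assumes "tree_arc T a (a + l)" "tree_arc T b (b + l)" "f j \<le> a" "f j \<le> b" "a + l < f (j + h + 1)" "b + l < f (j + h + 1)" "n - 2 \<le> l"
  shows "a = b"
  using window_le[of j] arc_noncross[OF assms(1,2)] arc_noncross[OF assms(2,1)] assms(3-7) by linarith

text \<open>Shifted by one turn, the second arc starts at \<open>d - l' + m = d + l\<close>. As
  \<open>d < a\<close>, this is before the end \<open>a + l\<close> of the first arc, while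
  \<open>d + m\<close> is beyond it, so the two cross.\<close>

lemma opposite_arcs:
  assumes "1 \<le> t" "t \<le> h" "l + l' = m" "n - 1 \<le> l" "n - 1 \<le> l'"
    and a: "tree_arc T a (a + l)" "f t \<le> a" "a + l < f (t + h + 1)"
    and d: "tree_arc T (d - l') d" "f (t - 1 - h) \<le> d - l'" "d < f t"
  shows False
proof -
  have D: "tree_arc T (d - l' + m) (d + m)" using arc_shift[OF d(1), of 1] by simp
  have A: "tree_arc T (a + m) (a + l + m)" using arc_shift[OF a(1), of 1] by simp
  have "f (t + h) = f (t - 1 - h) + m" using f_per[of "t - 1 - h"] by (simp add: algebra_simps)
  moreover have "f (t + 2 * h + 1) = f t + m" using f_per[of t] by (simp add: add.assoc)
  moreover have "a < f (t + 1)" using a assms(4) f_win[of "t + 1"] by (simp add: algebra_simps)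
  moreover have "f (t + 1) \<le> f (t + h)" "f (t + h + 1) \<le> f (t + 2 * h)" using h_pos f_le by auto
  moreover have "f (t + 2 * h) \<le> d + m" using d(2) assms(5) f_win[of "t + h"] calculation(1) by (simp add: algebra_simps)
  ultimately show False
    using arc_noncross[OF a(1) D] arc_noncross[OF D A] assms(3) a(2,3) d(2,3) by linarith
qed

text \<open>
  The arcs counted by \<open>X\<close> and \<open>X'\<close> have pairwise distinct colors, and each of these colors except \<open>t1\<close>
  needs its own radial edge at a point of \<open>X \<union> X'\<close> outside \<open>E \<union> E'\<close>.
\<close>

lemma boundary_count:
  fixes X X' :: "int set"
  assumes t: "1 \<le> t" "t \<le> h" and l: "l + l' = m" "n - 1 \<le> l" "n - 1 \<le> l'"
    and X: "X = {f t..<f (t + h + 1) - l}" and X': "X' = {f (t - 1 - h) + l'..<f t}"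
    and E: "E \<subseteq> X" "f t \<notin> E" "\<And>y. y \<in> E \<Longrightarrow> t = h \<and> (\<forall>T. \<not> spine T (f 0) y)"
    and E': "E' \<subseteq> X'" "f t - 1 \<notin> E'" "\<And>v. v \<in> E' \<Longrightarrow> t = 1 \<and> (\<forall>T. \<not> spine T v (f (h + 1) - 1))"
    and ne: "0 < card E + card E'"
  shows "card E + card E' = 1 \<and> ((\<exists>a\<in>X. tree_arc t1 a (a + l)) \<or> (\<exists>d\<in>X'. tree_arc t1 (d - l') d))"
proof -
  define k where "k a = col a (a + l)" for a
  define k' where "k' d = col (d - l') d" for d
  have fin: "finite X" "finite X'" "finite E" "finite E'"
    using X X' finite_subset[OF E(1)] finite_subset[OF E'(1)] by auto
  have n4: "4 \<le> n" by (rule n_ge)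
  have ft: "t - 1 - h + h + 1 = t" by simp
  have arcX: "tree_arc (k a) a (a + l)" if "a \<in> X" for a
    unfolding tree_arc_def k_def using that window_short[of t a "a + l"] l n4 unfolding X by auto
  have arcX': "tree_arc (k' d) (d - l') d" if "d \<in> X'" for d
    unfolding tree_arc_def k'_def using that window_short[of "t - 1 - h" "d - l'" d] l n4 ft unfolding X' by auto
  have inj: "inj_on k X"
  proof (rule inj_onI)
    fix a b assume ab: "a \<in> X" "b \<in> X" "k a = k b"
    show "a = b" by (rule parallel_arcs[of "k a" a l b t]) (use ab arcX[of a] arcX[of b] l X in auto)
  qed
  have inj': "inj_on k' X'"
  proof (rule inj_onI)
    fix a b assume ab: "a \<in> X'" "b \<in> X'" "k' a = k' b"
    have "a - l' = b - l'"
      by (rule parallel_arcs[of "k' a" "a - l'" l' "b - l'" "t - 1 - h"]) (use ab arcX'[of a] arcX'[of b] l X' ft in auto)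
    then show "a = b" by simp
  qed
  have disj: "k ` X \<inter> k' ` X' = {}"
  proof (rule ccontr)
    assume "\<not> ?thesis"
    then obtain a d where "a \<in> X" "d \<in> X'" "k a = k' d" by force
    then show False using opposite_arcs[OF t l, of "k a" a d] arcX[of a] arcX'[of d] X X' by auto
  qed
  have ftm: "f t \<in> X" "f t - 1 \<in> X'"
    using window_ge[of t] window_ge[of "t - 1 - h"] l window_le[of t] m_eq n4 f_win[of t] f_win[of "t - 1 - h"] ft
    unfolding X X' by auto
  have sz: "card (k ` X \<union> k' ` X') = card X + card X'"
    using card_Un_disjoint[OF _ _ disj] fin card_image[OF inj] card_image[OF inj'] by simp
  have sub: "(k ` X \<union> k' ` X') - {t1} \<subseteq> rc ` ((X - E) \<union> (X' - E'))"
  proof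
    fix T assume T: "T \<in> (k ` X \<union> k' ` X') - {t1}"
    have base: "rc (f t) \<in> rc ` ((X - E) \<union> (X' - E'))" "rc (f t - 1) \<in> rc ` ((X - E) \<union> (X' - E'))"
      using ftm E(2) E'(2) by auto
    show "T \<in> rc ` ((X - E) \<union> (X' - E'))"
    proof (cases "T \<in> k ` X")
      case True
      then obtain a where a: "a \<in> X" "T = k a" by auto
      have A: "tree_arc T a (a + l)" using arcX a by auto
      have a1: "f t \<le> a" "a + l < f (t + h + 1)" using a X by auto
      have "a < f (t + 1)" "f (t + h) \<le> a + l"
        using a1 l f_win[of "t + 1"] f_win[of t] by (auto simp: algebra_simps)
      then have "T \<noteq> t0" using t0_not_right[OF t a1(1)] A by auto
      then have "rc (f t - 1) = T \<or> rc (f t) = T \<or> (\<exists>y. f t \<le> y \<and> y \<le> a \<and> rc y = T \<and> spine T (f (t - h)) y)"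
        by (intro right_boundary_arc[OF arc_I[OF A] _ _ t A a1]) (use T l in auto)
      moreover have "y \<in> X - E" if "f t \<le> y" "y \<le> a" "spine T (f (t - h)) y" for y
        using that a1 E(3)[of y] X by auto
      ultimately show ?thesis using base by (elim disjE exE conjE) blast+
    next
      case False
      then obtain d where d: "d \<in> X'" "T = k' d" using T by auto
      have A: "tree_arc T (d - l') d" using arcX' d by auto
      have d1: "f (t - 1 - h) \<le> d - l'" "d < f t" using d X' by auto
      have "d - l' < f (t - h)" "f (t - 1) \<le> d"
        using d1 l f_win[of "t - h"] f_win[of "t - 1 - h"] by (auto simp: algebra_simps)
      then have "T \<noteq> t0" using t0_not_left[OF t] A by auto
      then have "rc (f t - 1) = T \<or> rc (f t) = T \<or> (\<exists>v. d \<le> v \<and> v < f t \<and> rc v = T \<and> spine T v (f (t + h) - 1))"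
        by (intro left_boundary_arc[OF arc_I[OF A] _ _ t A d1]) (use T l in auto)
      moreover have "v \<in> X' - E'" if "d \<le> v" "v < f t" "spine T v (f (t + h) - 1)" for v
        using that d1 E'(3)[of v] X' by (auto simp: add.commute)
      ultimately show ?thesis using base by (elim disjE exE conjE) blast+
    qed
  qed
  have "card ((k ` X \<union> k' ` X') - {t1}) \<le> card ((X - E) \<union> (X' - E'))"
    using card_mono[OF _ sub] card_image_le[of "(X - E) \<union> (X' - E')" rc] fin by force
  also have "\<dots> \<le> card (X - E) + card (X' - E')" by (rule card_Un_le)
  also have "\<dots> = (card X - card E) + (card X' - card E')"
    using E(1) E'(1) fin by (simp add: card_Diff_subset)
  finally have le: "card ((k ` X \<union> k' ` X') - {t1}) \<le> (card X - card E) + (card X' - card E')" .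
  have cle: "card E \<le> card X" "card E' \<le> card X'" using card_mono E(1) E'(1) fin by auto
  \<comment> \<open>Without \<open>t1\<close> there would be more trees than available points as
    soon as one point is excluded.\<close>
  have "t1 \<in> k ` X \<union> k' ` X'"
  proof (rule ccontr)
    assume "\<not> ?thesis"
    then have "(k ` X \<union> k' ` X') - {t1} = k ` X \<union> k' ` X'" by blast
    then show False using le sz cle ne by arith
  qed
  then show ?thesis
    using le sz cle ne arcX arcX' fin by (auto simp: card_Diff_singleton)
qed

text \<open>
  By the zigzag property, each arc of length \<open>l + 1\<close> within groups \<open>0, \<dots>, h\<close> has a child of length \<open>l\<close>,
  and there is only one more arc of length \<open>l\<close>, so only one of them can be a spine.
\<close>

lemma window_starts:
  assumes l: "n - 2 \<le> l" "l \<le> n - 1" and s: "spine T (f 0) (f 0 + l)" "spine T' (f (h + 1) - 1 - l) (f (h + 1) - 1)"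
  shows False
proof -
  define k where "k a = col a (a + l)" for a
  define k1 where "k1 a = col a (a + (l + 1))" for a
  define B where "B = {f 0..<f (h + 1) - l}"
  define B1 where "B1 = {f 0..<f (h + 1) - (l + 1)}"
  have w: "n + 2 \<le> f (h + 1) - f 0" using window_ge[of 0] by simp
  have n4: "4 \<le> n" by (rule n_ge)
  have arcB: "tree_arc (k a) a (a + l)" if "a \<in> B" for a
    unfolding tree_arc_def k_def using that window_short[of 0 a "a + l"] l n4 unfolding B_def by auto
  have arcB1: "tree_arc (k1 a) a (a + (l + 1))" if "a \<in> B1" for a
    unfolding tree_arc_def k1_def using that window_short[of 0 a "a + (l + 1)"] l n4 unfolding B1_def by auto
  have inj1: "inj_on k1 B1"
  proof (rule inj_onI)
    fix a b assume ab: "a \<in> B1" "b \<in> B1" "k1 a = k1 b"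
    show "a = b" by (rule parallel_arcs[of "k1 a" a "l + 1" b 0]) (use ab arcB1[of a] arcB1[of b] l B1_def in auto)
  qed
  let ?x = "f (h + 1) - 1 - l"
  have "k1 ` B1 \<subseteq> k ` (B - {f 0, ?x})"
  proof
    fix S assume "S \<in> k1 ` B1"
    then obtain a where a: "a \<in> B1" "S = k1 a" by auto
    have A: "tree_arc S a (a + (l + 1))" using arcB1 a by simp
    have "tree_arc S (a + 1) (a + 1 + l) \<or> tree_arc S a (a + l)"
      using child[OF A] l n4 by (simp add: algebra_simps)
    then obtain b where b: "b \<in> {a, a + 1}" "tree_arc S b (b + l)" by blast
    have "b \<in> B" using a b unfolding B_def B1_def by auto
    moreover have "b \<noteq> f 0"
    proof
      assume e: "b = f 0"
      have "S = T" by (rule arc_eq[of S "f 0" "f 0 + l"]) (use b(2) s(1) e in \<open>simp_all add: spine_def\<close>)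
      moreover have "a = f 0" using a(1) b(1) e unfolding B1_def by auto
      ultimately have A': "tree_arc T (f 0) (f 0 + (l + 1))" using A by simp
      have "f 0 + (l + 1) = f 0 + l"
        using s(1)[unfolded spine_def, THEN conjunct2, rule_format, OF A'] by simp
      then show False by simp
    qed
    moreover have "b \<noteq> ?x"
    proof
      assume e: "b = ?x"
      have "S = T'" by (rule arc_eq[of S ?x "f (h + 1) - 1"]) (use b(2) s(2) e in \<open>simp_all add: spine_def\<close>)
      moreover have e2: "a + 1 = ?x" using a(1) b(1) e unfolding B1_def by auto
      moreover have "\<forall>c d. tree_arc T' c d \<longrightarrow> c \<le> ?x \<longrightarrow> f (h + 1) - 1 \<le> d \<longrightarrow> c = ?x" using s(2) unfolding spine_def by simp
      ultimately have "a = ?x" using A by simp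
      then show False using e2 by simp
    qed
    ultimately have "b \<in> B - {f 0, ?x}" by simp
    moreover have "S = k b" using b(2) unfolding k_def tree_arc_def by simp
    ultimately show "S \<in> k ` (B - {f 0, ?x})" by (rule rev_image_eqI)
  qed
  then have "card (k1 ` B1) \<le> card (k ` (B - {f 0, ?x}))" by (intro card_mono) (auto simp: B_def)
  also have "\<dots> \<le> card (B - {f 0, ?x})" by (rule card_image_le) (simp add: B_def)
  \<comment> \<open>The two starts differ because the window has at least \<open>n + 2\<close>
    points. Two arcs are lost, although \<open>B\<close> exceeds \<open>B1\<close> by only
    one.\<close>
  also have "\<dots> = card B - card {f 0, ?x}"
    by (rule card_Diff_subset) (use w l n4 in \<open>simp_all add: B_def\<close>)
  also have "\<dots> = card B - 2" using w l n4 by simp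
  finally have "card B1 \<le> card B - 2" using card_image[OF inj1] by simp
  then show False using w l n4 unfolding B_def B1_def by simp
qed

section \<open>Spines at the extreme groups and the final count\<close>

definition top_start :: "int \<Rightarrow> bool" where "top_start l \<longleftrightarrow> (\<exists>T. spine T (f 0) (f 0 + l))"
definition left_start :: "int \<Rightarrow> bool" where "left_start l \<longleftrightarrow> (\<exists>T. spine T (f (h + 1) - 1 - l) (f (h + 1) - 1))"

lemma not_top_left: "n - 2 \<le> l \<Longrightarrow> l \<le> n - 1 \<Longrightarrow> top_start l \<Longrightarrow> left_start l \<Longrightarrow> False"
  unfolding top_start_def left_start_def using window_starts by blast

text \<open>\<open>n - 2 \<le> l\<close> puts \<open>f 0 + l\<close> strictly after
  \<open>f h\<close>, and \<open>l < l'\<close> keeps it in the set \<open>X\<close> of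
  \<open>boundary_count\<close> for \<open>t = h\<close>. If no spine of length \<open>l\<close>
  starts at \<open>f 0\<close>, this position cannot serve in the count.\<close>

lemma top_excluded:
  assumes E: "E = {y. \<exists>l\<in>L. y = f 0 + l \<and> \<not> top_start l}" and L: "\<And>l. l \<in> L \<Longrightarrow> n - 2 \<le> l \<and> l < l'" and lm: "l' + lz = m"
  shows "E \<subseteq> {f h..<f (h + h + 1) - lz}" "f h \<notin> E" "\<And>y. y \<in> E \<Longrightarrow> (\<forall>T. \<not> spine T (f 0) y)"
proof -
  have w1: "f h - f 0 \<le> n - 3" using f_win[of 0] by simp
  have w2: "f (h + h + 1) = f 0 + m" using f0_m by (simp only: mult_2)
  have ins: "y \<in> {f h..<f (h + h + 1) - lz} \<and> y \<noteq> f h \<and> (\<forall>T. \<not> spine T (f 0) y)" if yE: "y \<in> E" for y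
  proof -
    obtain l where l: "l \<in> L" "y = f 0 + l" "\<not> top_start l" using yE unfolding E by auto
    have "f h < y" "y < f (h + h + 1) - lz" using L[OF l(1)] l(2) lm w1 w2 by linarith+
    then show ?thesis using l(2,3) unfolding top_start_def by simp
  qed
  show "E \<subseteq> {f h..<f (h + h + 1) - lz}" using ins by blast
  show "f h \<notin> E" using ins[of "f h"] by blast
  show "\<And>y. y \<in> E \<Longrightarrow> (\<forall>T. \<not> spine T (f 0) y)" using ins by blast
qed

text \<open>Mirror image of \<open>top_excluded\<close>, for the set \<open>X'\<close> at the
  boundary \<open>t = 1\<close>.\<close>

lemma left_excluded:
  assumes E: "E = {y. \<exists>l\<in>L. y = f (h + 1) - 1 - l \<and> \<not> left_start l}" and L: "\<And>l. l \<in> L \<Longrightarrow> n - 2 \<le> l \<and> l < lz" and lm: "l' + lz = m"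
  shows "E \<subseteq> {f (1 - 1 - h) + l'..<f 1}" "f 1 - 1 \<notin> E" "\<And>v. v \<in> E \<Longrightarrow> (\<forall>T. \<not> spine T v (f (h + 1) - 1))"
proof -
  have w1: "f (h + 1) - f 1 \<le> n - 3" using f_win[of 1] by (simp only: add.commute)
  have w2: "f (1 - 1 - h) = f (h + 1) - m" using fh_m by simp
  have ins: "v \<in> {f (1 - 1 - h) + l'..<f 1} \<and> v \<noteq> f 1 - 1 \<and> (\<forall>T. \<not> spine T v (f (h + 1) - 1))" if vE: "v \<in> E" for v
  proof -
    obtain l where l: "l \<in> L" "v = f (h + 1) - 1 - l" "\<not> left_start l" using vE unfolding E by auto
    have "f (1 - 1 - h) + l' \<le> v" "v < f 1 - 1" using L[OF l(1)] l(2) lm w1 w2 by linarith+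
    then show ?thesis using l(2,3) unfolding left_start_def by simp
  qed
  show "E \<subseteq> {f (1 - 1 - h) + l'..<f 1}" using ins by blast
  show "f 1 - 1 \<notin> E" using ins[of "f 1 - 1"] by blast
  show "\<And>v. v \<in> E \<Longrightarrow> (\<forall>T. \<not> spine T v (f (h + 1) - 1))" using ins by blast
qed

text \<open>By \<open>not_top_left\<close> each of the lengths \<open>n - 1\<close> and
  \<open>n - 2\<close> contributes to \<open>Et\<close> or to \<open>El\<close>, whereas a boundary
  count admits at most one excluded point.\<close>

lemma contradiction: False
proof -
  have n4: "4 \<le> n" by (rule n_ge)
  have lm: "(n - 1) + n = m" "n + (n - 1) = m" using m_eq by auto
  define Et where "Et L = {y. \<exists>l\<in>L. y = f 0 + l \<and> \<not> top_start l}" for L :: "int set"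
  define El where "El L = {y. \<exists>l\<in>L. y = f (h + 1) - 1 - l \<and> \<not> left_start l}" for L :: "int set"
  have Et1: "Et {a} = (if top_start a then {} else {f 0 + a})" for a unfolding Et_def by auto
  have Et2: "Et {a, b} = Et {a} \<union> Et {b}" for a b unfolding Et_def by auto
  have El1: "El {a} = (if left_start a then {} else {f (h + 1) - 1 - a})" for a unfolding El_def by auto
  have El2: "El {a, b} = El {a} \<union> El {b}" for a b unfolding El_def by auto
  let ?x1 = "n - 1" and ?x2 = "n - 2"
  have tl1: "\<not> (top_start ?x1 \<and> left_start ?x1)" and tl2: "\<not> (top_start ?x2 \<and> left_start ?x2)"
    using not_top_left[of ?x1] not_top_left[of ?x2] by auto
  have ct: "card (Et {?x1, ?x2}) = (if top_start ?x1 then 0 else 1) + (if top_start ?x2 then 0 else 1)"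
    unfolding Et2 Et1 by auto
  have cl: "card (El {?x1, ?x2}) = (if left_start ?x1 then 0 else 1) + (if left_start ?x2 then 0 else 1)"
    unfolding El2 El1 by auto
  have ct2: "card (Et {?x2}) = (if top_start ?x2 then 0 else 1)" unfolding Et1 by auto
  have cl2: "card (El {?x2}) = (if left_start ?x2 then 0 else 1)" unfolding El1 by auto
  have tA: "Et {?x1, ?x2} \<subseteq> {f h..<f (h + h + 1) - (n - 1)}" "f h \<notin> Et {?x1, ?x2}"
      "\<And>y. y \<in> Et {?x1, ?x2} \<Longrightarrow> \<forall>T. \<not> spine T (f 0) y"
    by (rule top_excluded[OF Et_def, where l' = n]; use lm in auto)+
  have tB: "Et {?x2} \<subseteq> {f h..<f (h + h + 1) - n}" "f h \<notin> Et {?x2}"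
      "\<And>y. y \<in> Et {?x2} \<Longrightarrow> \<forall>T. \<not> spine T (f 0) y"
    by (rule top_excluded[OF Et_def, where l' = "n - 1"]; use lm in auto)+
  have lA: "El {?x1, ?x2} \<subseteq> {f (1 - 1 - h) + (n - 1)..<f 1}" "f 1 - 1 \<notin> El {?x1, ?x2}"
      "\<And>v. v \<in> El {?x1, ?x2} \<Longrightarrow> \<forall>T. \<not> spine T v (f (h + 1) - 1)"
    by (rule left_excluded[OF El_def, where lz = n]; use lm in auto)+
  have lB: "El {?x2} \<subseteq> {f (1 - 1 - h) + n..<f 1}" "f 1 - 1 \<notin> El {?x2}"
      "\<And>v. v \<in> El {?x2} \<Longrightarrow> \<forall>T. \<not> spine T v (f (h + 1) - 1)"
    by (rule left_excluded[OF El_def, where lz = "n - 1"]; use lm in auto)+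
  have p: "n - 1 \<le> n - 1" and p': "n - 1 \<le> n" by auto
  note tA3 = conjI[OF refl[of h] tA(3)] and tB3 = conjI[OF refl[of h] tB(3)]
  have el: "{} \<subseteq> S" "x \<notin> {}" "v \<in> {} \<Longrightarrow> P" for S :: "int set" and x v :: int and P by auto
  show False
  proof (cases "h = 1")
    case True
    have e: "f (1 - 1 - h) = f (h - 1 - h)" "f (1::int) = f h" using True by auto
    have A: "card (Et {?x1, ?x2}) + card (El {?x2}) \<le> 1"
    proof (cases "0 < card (Et {?x1, ?x2}) + card (El {?x2})")
      case pos: True
      show ?thesis
        using boundary_count[OF h_pos order_refl lm(1) p p' refl refl tA(1,2) tA3 lB(1,2)[unfolded e] conjI[OF True lB(3)] pos]
        by linarith
    qed simp
    have B: "card (Et {?x2}) + card (El {?x1, ?x2}) \<le> 1"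
    proof (cases "0 < card (Et {?x2}) + card (El {?x1, ?x2})")
      case pos: True
      show ?thesis
        using boundary_count[OF h_pos order_refl lm(2) p' p refl refl tB(1,2) tB3 lA(1,2)[unfolded e] conjI[OF True lA(3)] pos]
        by linarith
    qed simp
    show False using A B tl1 tl2 unfolding ct cl ct2 cl2 by (auto split: if_splits)
  next
    case False
    then have h2: "2 \<le> h" using h_pos by simp
    let ?X = "{f h..<f (h + h + 1) - (n - 1)}" and ?X' = "{f (h - 1 - h) + n..<f h}"
    let ?Y = "{f 1..<f (1 + h + 1) - n}" and ?Y' = "{f (1 - 1 - h) + (n - 1)..<f 1}"
    have A: "card (Et {?x1, ?x2}) = 1 \<and> ((\<exists>a\<in>?X. tree_arc t1 a (a + (n - 1))) \<or> (\<exists>d\<in>?X'. tree_arc t1 (d - n) d))"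
      if pos: "0 < card (Et {?x1, ?x2})"
    proof -
      have "0 < card (Et {?x1, ?x2}) + card ({} :: int set)" using pos by simp
      from boundary_count[OF h_pos order_refl lm(1) p p' refl refl tA(1,2) tA3 el this]
      show ?thesis by simp
    qed
    have B: "card (El {?x1, ?x2}) = 1 \<and> ((\<exists>a\<in>?Y. tree_arc t1 a (a + n)) \<or> (\<exists>d\<in>?Y'. tree_arc t1 (d - (n - 1)) d))"
      if pos: "0 < card (El {?x1, ?x2})"
    proof -
      have "0 < card ({} :: int set) + card (El {?x1, ?x2})" using pos by simp
      from boundary_count[OF order_refl h_pos lm(2) p' p refl refl el lA(1,2) conjI[OF refl lA(3)] this]
      show ?thesis by simp
    qed
    have w: "f 2 \<le> f h" "f (h + 1) - f 1 \<le> n - 3" "f (2 * h) - f h \<le> n - 3" "f (2 * h + 1) - f (h + 1) \<le> n - 3" "f (h + 2) \<le> f (2 * h)"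
      "f (h + 2) - f 2 \<le> n - 3" "f 0 - f (- h) \<le> n - 3" "f (h - 1) - f (- 1) \<le> n - 3" "f h - f 0 \<le> n - 3"
      "f 1 - f (1 - h) \<le> n - 3" "f (1 - h) \<le> f (- 1)" "f 1 \<le> f (h - 1)"
      "f (h + 1) = f (- h) + m" "f (2 * h + 1) = f 0 + m" "f (2 * h) = f (- 1) + m" "f 0 < f 1" "f 1 < f 2" "f (h + 1) < f (h + 2)" "f (- 1) < f 0"
      "f (h - 1) < f h" "f h < f (h + 1)" "f (2 * h) < f (2 * h + 1)"
      using f_le[of 2 h] f_win[of 1] f_win[of h] f_win[of "h + 1"] f_le[of "h + 2" "2 * h"] f_win[of 2] f_win[of "- h"] f_win[of "- 1"]
        f_win[of 0] f_win[of "1 - h"] f_le[of "1 - h" "- 1"] f_le[of 1 "h - 1"] fh_m f0_m f_per[of "- 1"] h2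
        f_step[of 0] f_step[of 1] f_step[of "h + 1"] f_step[of "- 1"] f_step[of "h - 1"] f_step[of h] f_step[of "2 * h"]
      by (simp_all add: algebra_simps)
    \<comment> \<open>The two sets have at least two elements together and at most one each, so
      neither is empty and both counts involve \<open>t1\<close>.\<close>
    have "(\<exists>a\<in>?X. tree_arc t1 a (a + (n - 1))) \<or> (\<exists>d\<in>?X'. tree_arc t1 (d - n) d)"
      "(\<exists>a\<in>?Y. tree_arc t1 a (a + n)) \<or> (\<exists>d\<in>?Y'. tree_arc t1 (d - (n - 1)) d)"
      using A B tl1 tl2 unfolding ct cl by (auto split: if_splits)
    then consider a b where "a \<in> ?X" "tree_arc t1 a (a + (n - 1))" "b \<in> ?Y" "tree_arc t1 b (b + n)"
      | a d where "a \<in> ?X" "tree_arc t1 a (a + (n - 1))" "d \<in> ?Y'" "tree_arc t1 (d - (n - 1)) d"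
      | d b where "d \<in> ?X'" "tree_arc t1 (d - n) d" "b \<in> ?Y" "tree_arc t1 b (b + n)"
      | d e where "d \<in> ?X'" "tree_arc t1 (d - n) d" "e \<in> ?Y'" "tree_arc t1 (e - (n - 1)) e"
      by blast
    \<comment> \<open>In every combination the two arcs of \<open>t1\<close> cross, in the mixed
      ones after a full turn is added where needed.\<close>
    then show False
    proof cases
      case 1
      then show False using arc_noncross[OF 1(4,2)] w by (auto simp: add.commute[of 2 h])
    next
      case 2
      have "tree_arc t1 (d - (n - 1) + m) (d + m)" using arc_shift[OF 2(4), of 1] by simp
      then show False using arc_noncross[OF 2(2), of "d - (n - 1) + m" "d + m"] 2 w by auto
    next
      case 3
      have s: "tree_arc t1 (d - n + m) (d + m)" using arc_shift[OF 3(2), of 1] by simp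
      have "f (- 1) + n \<le> d" "d < f h" "f 1 \<le> b" "b + n < f (h + 2)"
        using 3(1,3) by (simp_all add: add.commute[of 2 h])
      then show False using arc_noncross[OF 3(2,4)] arc_noncross[OF 3(4) s] w m_eq by linarith
    next
      case 4
      then show False using arc_noncross[OF 4(4,2)] w by auto
    qed
  qed
qed

end

section \<open>Realization by points\<close>

lemma Arg_near_one:
  assumes "0 < \<eta>"
  shows "\<exists>\<delta>>0. \<forall>w. cmod w < \<delta> \<longrightarrow> 1 + w \<noteq> 0 \<and> \<bar>Arg (1 + w)\<bar> < \<eta>"
proof -
  have "isCont Arg 1" by (rule continuous_at_Arg) simp
  then obtain d where d: "0 < d" "\<And>x. dist x 1 < d \<Longrightarrow> dist (Arg x) (Arg 1) < \<eta>"
    using assms unfolding continuous_at_eps_delta by blast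
  have "1 + w \<noteq> 0 \<and> \<bar>Arg (1 + w)\<bar> < \<eta>" if "cmod w < min d 1" for w
  proof
    show "1 + w \<noteq> 0"
    proof
      assume "1 + w = 0"
      then have "w = - 1" by (simp add: eq_neg_iff_add_eq_0 add.commute)
      then show False using that by simp
    qed
    show "\<bar>Arg (1 + w)\<bar> < \<eta>" using d(2)[of "1 + w"] that by (simp add: dist_norm)
  qed
  then show ?thesis using d(1) by (intro exI[of _ "min d 1"]) auto
qed

lemma ex_increasing_enumeration:
  fixes g :: "'a \<Rightarrow> real"
  assumes "finite S" "inj_on g S"
  shows "\<exists>e. bij_betw e {..<card S} S \<and> (\<forall>a b. a < b \<longrightarrow> b < card S \<longrightarrow> g (e a) < g (e b))"
proof -
  let ?xs = "sorted_list_of_set (g ` S)"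
  define u where "u = (!) ?xs"
  have c: "card (g ` S) = card S" by (rule card_image[OF assms(2)])
  have len: "length ?xs = card S" using c by simp
  have u: "bij_betw u {..<card S} (g ` S)"
    unfolding u_def using assms(1) len by (intro bij_betw_nth) auto
  have mono: "u a < u b" if "a < b" "b < card S" for a b
    unfolding u_def using sorted_wrt_nth_less[OF strict_sorted_list_of_set that(1), of "g ` S"] that(2) len by simp
  let ?e = "inv_into S g \<circ> u"
  have "bij_betw ?e {..<card S} S"
    using bij_betw_trans[OF u bij_betw_inv_into[OF inj_on_imp_bij_betw[OF assms(2)]]] by simp
  moreover have "g (?e a) < g (?e b)" if "a < b" "b < card S" for a b
  proof -
    have "u a \<in> g ` S" "u b \<in> g ` S" using u that unfolding bij_betw_def by auto
    then have "g (?e a) = u a" "g (?e b) = u b" by (simp_all add: f_inv_into_f)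
    then show ?thesis using mono that by simp
  qed
  ultimately show ?thesis by blast
qed

text \<open>The tolerance is chosen so that two deviations together stay below
  \<open>pi / (2 * k)\<close>. This is less than the step \<open>2 * pi / k\<close> between groups
  and, as \<open>k\<close> is odd, less than the distance \<open>pi / k\<close> of the multiples of
  that step from \<open>pi\<close>. So the order of the groups and the side of the center
  survive.\<close>

locale geometric_wheel =
  fixes N :: "nat list" and k n :: nat and v z :: complex and \<epsilon> :: real and G :: "nat \<Rightarrow> complex set"
  assumes k_eq: "k = length N" and k3: "3 \<le> k" and k_odd: "odd k"
    and N_pos: "\<And>i. i < k \<Longrightarrow> 1 \<le> N ! i"
    and n_eq: "2 * n = 1 + (\<Sum>i<k. N ! i)"
    and z0: "z \<noteq> 0"
    and window: "\<And>j. j < k \<Longrightarrow> int (\<Sum>i<(k - 1) div 2. N ! ((j + i) mod k)) < int n - 2"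
    and gw: "generalized_wheel N v z \<epsilon> G"
    and tol: "\<And>w. cmod w < \<epsilon> / cmod z \<Longrightarrow> 1 + w \<noteq> 0 \<and> \<bar>Arg (1 + w)\<bar> < pi / (4 * real k)"
begin

definition h :: int where "h = int ((k - 1) div 2)"
definition m :: int where "m = 2 * int n - 1"
text \<open>Partial sums of \<open>N\<close> on one period, continued to all integers so that
  \<open>k\<close> groups amount to \<open>m\<close> points.\<close>

definition f :: "int \<Rightarrow> int" where
  "f j = (j div int k) * m + (\<Sum>i<nat (j mod int k). int (N ! i))"

lemma k_h: "int k = 2 * h + 1"
  using k_odd unfolding h_def by (auto elim!: oddE)

lemma m_sum: "m = (\<Sum>i<k. int (N ! i))"
  using n_eq unfolding m_def by (simp flip: of_nat_sum)

lemma f_Suc: "f (j + 1) = f j + int (N ! nat (j mod int k))"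
proof -
  have kp: "0 < int k" using k3 by simp
  define q r where "q = j div int k" and "r = j mod int k"
  have j: "j = q * int k + r" "0 \<le> r" "r < int k" unfolding q_def r_def using kp by auto
  show ?thesis
  proof (cases "r + 1 < int k")
    case True
    have "(j + 1) div int k = q" "(j + 1) mod int k = r + 1"
      using j True by (auto intro: div_pos_pos_trivial mod_pos_pos_trivial simp: add.assoc)
    moreover have "nat (r + 1) = Suc (nat r)" using j by simp
    ultimately show ?thesis unfolding f_def using q_def r_def by simp
  next
    case False
    then have r: "r + 1 = int k" using j by simp
    have e: "j + 1 = (q + 1) * int k" using j r by (simp add: algebra_simps)
    have "(j + 1) div int k = q + 1" "(j + 1) mod int k = 0" unfolding e using kp by auto
    then have lhs: "f (j + 1) = (q + 1) * m" unfolding f_def by simp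
    have kS: "k = Suc (nat r)" using r j(2) by linarith
    have "m = (\<Sum>i<nat r. int (N ! i)) + int (N ! nat r)" unfolding m_sum by (subst kS) simp
    then show ?thesis unfolding lhs unfolding f_def q_def[symmetric] r_def[symmetric] by (simp add: distrib_right)
  qed
qed

lemma f_add: "f (j + int d) - f j = int (\<Sum>i<d. N ! ((nat (j mod int k) + i) mod k))"
proof (induction d)
  case (Suc d)
  have "nat ((j + int d) mod int k) = (nat (j mod int k) + d) mod k"
  proof -
    have "(j + int d) mod int k = (int (nat (j mod int k)) + int d) mod int k"
      using k3 by (simp add: mod_add_left_eq)
    also have "\<dots> = int ((nat (j mod int k) + d) mod k)" by (simp add: zmod_int)
    finally show ?thesis by simp
  qed
  then show ?case using Suc f_Suc[of "j + int d"] by (simp add: algebra_simps)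
qed simp

sublocale cyclic_groups f m "int n" h
proof
  show "1 \<le> h" using k_h k3 by simp
  show "m = 2 * int n - 1" by (rule m_def)
  show "f j < f (j + 1)" for j
    using f_Suc[of j] N_pos[of "nat (j mod int k)"] k3 by (simp add: nat_less_iff)
  show "f (j + (2 * h + 1)) = f j + m" for j
    unfolding k_h[symmetric] f_def using k3 by (simp add: algebra_simps)
  show "f (j + h) - f j \<le> int n - 3" for j
    using f_add[of j "(k - 1) div 2"] window[of "nat (j mod int k)"] k3
    unfolding h_def by (simp add: nat_less_iff)
qed

definition grp :: "int \<Rightarrow> int" where "grp a = (SOME j. f j \<le> a \<and> a < f (j + 1))"

lemma grp: "f (grp a) \<le> a" "a < f (grp a + 1)"
proof -
  have "\<exists>j. f j \<le> a \<and> a < f (j + 1)" using group_of[of a] by blast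
  then have "f (grp a) \<le> a \<and> a < f (grp a + 1)" unfolding grp_def by (rule someI_ex)
  then show "f (grp a) \<le> a" "a < f (grp a + 1)" by auto
qed

lemma grp_eq: "f j \<le> a \<Longrightarrow> a < f (j + 1) \<Longrightarrow> grp a = j"
  using grp[of a] f_less_iff[of j "grp a + 1"] f_less_iff[of "grp a" "j + 1"] by linarith

lemma grp_per: "grp (a + m) = grp a + int k"
proof (rule grp_eq)
  show "f (grp a + int k) \<le> a + m" using grp[of a] f_per[of "grp a"] k_h by simp
  show "a + m < f (grp a + int k + 1)" using grp[of a] f_per[of "grp a + 1"] k_h by (simp add: algebra_simps)
qed

lemma grp_ge: "f j \<le> a \<Longrightarrow> j \<le> grp a"
  using grp[of a] f_less_iff[of j "grp a + 1"] by linarith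

lemma grp_le: "a < f (j + 1) \<Longrightarrow> grp a \<le> j"
  using grp[of a] f_less_iff[of "grp a" "j + 1"] by linarith

section \<open>Angles and the enumeration of the hull points\<close>

definition V :: "complex set" where "V = wheel_points N v G"
definition dir :: "nat \<Rightarrow> complex" where "dir i = z * cis (2 * pi * real i / real k)"
definition dev :: "nat \<Rightarrow> complex \<Rightarrow> real" where "dev i p = Arg ((p - v) / dir i)"

lemma dir0: "dir i \<noteq> 0" unfolding dir_def using z0 by simp

lemma norm_dir: "cmod (dir i) = cmod z" unfolding dir_def by (simp add: norm_mult)

lemma G_finite: "i < k \<Longrightarrow> finite (G i)" and G_card: "i < k \<Longrightarrow> card (G i) = N ! i"
  and G_dist: "i < k \<Longrightarrow> p \<in> G i \<Longrightarrow> dist p (v + dir i) < \<epsilon>"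
  using gw unfolding generalized_wheel_def k_eq[symmetric] regular_polygon_vertex_def dir_def by auto

lemma G_V: "i < k \<Longrightarrow> p \<in> G i \<Longrightarrow> p \<in> V"
  unfolding V_def wheel_points_def k_eq by auto

lemma v_V: "v \<in> V" unfolding V_def wheel_points_def by auto

lemma V_cases: "p \<in> V \<Longrightarrow> p = v \<or> (\<exists>i<k. p \<in> G i)"
  unfolding V_def wheel_points_def k_eq by auto

lemma G_ratio:
  assumes "i < k" "p \<in> G i"
  obtains w where "(p - v) / dir i = 1 + w" "1 + w \<noteq> 0" "\<bar>dev i p\<bar> < pi / (4 * real k)"
proof -
  define w where "w = (p - (v + dir i)) / dir i"
  have "(p - v) / dir i = 1 + w" unfolding w_def using dir0[of i] by (simp add: field_simps)
  moreover have "cmod w < \<epsilon> / cmod z"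
    unfolding w_def using G_dist[OF assms] z0 by (simp add: norm_divide norm_dir dist_norm divide_strict_right_mono)
  ultimately show ?thesis using that tol[of w] unfolding dev_def by auto
qed

lemma G_not_center: "i < k \<Longrightarrow> p \<in> G i \<Longrightarrow> p \<noteq> v"
  by (rule G_ratio[of i p]) auto

lemma G_polar:
  assumes "i < k" "p \<in> G i"
  shows "p - v = dir i * (of_real (cmod (p - v) / cmod z) * cis (dev i p))"
proof -
  have "(p - v) / dir i = of_real (cmod ((p - v) / dir i)) * cis (dev i p)"
    unfolding dev_def using rcis_cmod_Arg[of "(p - v) / dir i"] unfolding rcis_def by simp
  also have "cmod ((p - v) / dir i) = cmod (p - v) / cmod z" by (simp add: norm_divide norm_dir)
  finally show ?thesis using dir0[of i] by (simp add: field_simps)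
qed

text \<open>Two points of a group at the same angle would be collinear with the center.\<close>

lemma dev_inj: assumes "i < k" shows "inj_on (dev i) (G i)"
proof (rule inj_onI, rule ccontr)
  fix p q assume pq: "p \<in> G i" "q \<in> G i" "dev i p = dev i q" "p \<noteq> q"
  define u where "u = dir i * cis (dev i p)"
  have p: "p = v + (cmod (p - v) / cmod z) *\<^sub>R u"
    using G_polar[OF assms pq(1)] unfolding u_def by (simp add: scaleR_conv_of_real algebra_simps)
  have q: "q = v + (cmod (q - v) / cmod z) *\<^sub>R u"
    using G_polar[OF assms pq(2)] pq(3) unfolding u_def by (simp add: scaleR_conv_of_real algebra_simps)
  have "collinear {v, p, q}"
    unfolding collinear_def
  proof (intro exI[of _ u] ballI)
    have al: "\<exists>c. x = v + c *\<^sub>R u" if "x \<in> {v, p, q}" for x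
      using that p q by (metis add.right_neutral empty_iff insert_iff scaleR_zero_left)
    fix x y assume "x \<in> {v, p, q}" "y \<in> {v, p, q}"
    then obtain c d where "x = v + c *\<^sub>R u" "y = v + d *\<^sub>R u" using al by metis
    then show "\<exists>c. x - y = c *\<^sub>R u" by (intro exI[of _ "c - d"]) (simp add: scaleR_left_diff_distrib)
  qed
  moreover have "general_position V" using gw unfolding generalized_wheel_def V_def by simp
  ultimately show False
    using G_V[OF assms pq(1)] G_V[OF assms pq(2)] v_V G_not_center[OF assms] pq unfolding general_position_def by metis
qed

definition enum :: "nat \<Rightarrow> nat \<Rightarrow> complex" where
  "enum i = (SOME e. bij_betw e {..<card (G i)} (G i) \<and> (\<forall>a b. a < b \<longrightarrow> b < card (G i) \<longrightarrow> dev i (e a) < dev i (e b)))"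

lemma enum:
  assumes "i < k"
  shows "bij_betw (enum i) {..<N ! i} (G i)" "a < b \<Longrightarrow> b < N ! i \<Longrightarrow> dev i (enum i a) < dev i (enum i b)"
proof -
  have "bij_betw (enum i) {..<card (G i)} (G i) \<and> (\<forall>a b. a < b \<longrightarrow> b < card (G i) \<longrightarrow> dev i (enum i a) < dev i (enum i b))"
    unfolding enum_def by (rule someI_ex[OF ex_increasing_enumeration[OF G_finite[OF assms] dev_inj[OF assms]]])
  then show "bij_betw (enum i) {..<N ! i} (G i)" "a < b \<Longrightarrow> b < N ! i \<Longrightarrow> dev i (enum i a) < dev i (enum i b)"
    unfolding G_card[OF assms] by auto
qed

definition res :: "int \<Rightarrow> nat" where "res a = nat (grp a mod int k)"
definition pt :: "int \<Rightarrow> complex" where "pt a = enum (res a) (nat (a - f (grp a)))"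
text \<open>The group index is not reduced modulo \<open>k\<close>, so the angle grows by
  \<open>2 * pi\<close> in each period.\<close>

definition ang :: "int \<Rightarrow> real" where "ang a = 2 * pi * of_int (grp a) / real k + dev (res a) (pt a)"

lemma res_less: "res a < k" unfolding res_def using k3 by (simp add: nat_less_iff)

lemma offset: "nat (a - f (grp a)) < N ! res a"
  using grp[of a] f_Suc[of "grp a"] unfolding res_def by (simp add: nat_less_iff)

lemma pt_G: "pt a \<in> G (res a)"
  using enum(1)[OF res_less[of a]] offset[of a] unfolding pt_def bij_betw_def by auto

lemma pt_V: "pt a \<in> V" by (rule G_V[OF res_less pt_G])

lemma pt_v: "pt a \<noteq> v" by (rule G_not_center[OF res_less pt_G])

lemma pt_surj: assumes "p \<in> V" "p \<noteq> v" obtains a where "p = pt a"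
proof -
  obtain i where i: "i < k" "p \<in> G i" using V_cases[OF assms(1)] assms(2) by auto
  then obtain c where c: "c < N ! i" "p = enum i c" using enum(1)[OF i(1)] unfolding bij_betw_def by auto
  have "f (int i + 1) = f (int i) + int (N ! i)" using f_Suc[of "int i"] i by simp
  then have g: "grp (f (int i) + int c) = int i" using c by (intro grp_eq) auto
  then have "pt (f (int i) + int c) = p" unfolding pt_def res_def g using i c by simp
  then show ?thesis using that by metis
qed

lemma res_per: "res (a + m) = res a" unfolding res_def grp_per by simp

lemma pt_per: "pt (a + m) = pt a"
  unfolding pt_def res_per grp_per using f_per[of "grp a"] k_h by simp

lemma ang_per: "ang (a + m) = ang a + 2 * pi"
  unfolding ang_def res_per grp_per pt_per using k3 by (simp add: field_simps)

lemma dev_small: "\<bar>dev (res a) (pt a)\<bar> < pi / (4 * real k)"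
  by (rule G_ratio[OF res_less pt_G])

lemma ang_mono: assumes "a < b" shows "ang a < ang b"
proof (cases "grp a = grp b")
  case True
  then have r: "res a = res b" unfolding res_def by simp
  have "nat (a - f (grp a)) < nat (b - f (grp b))" using assms True grp[of a] by simp
  then have "dev (res b) (pt a) < dev (res b) (pt b)"
    using enum(2)[OF res_less[of b]] offset[of b] r unfolding pt_def by simp
  then show ?thesis unfolding ang_def using True r by simp
next
  case False
  have "grp a \<le> grp b" using grp_ge[of "grp a" b] grp[of a] assms by simp
  then have "of_int (grp a) + 1 \<le> (of_int (grp b) :: real)" using False by linarith
  then have "2 * pi / real k * (of_int (grp a) + 1) \<le> 2 * pi / real k * of_int (grp b)"
    by (intro mult_left_mono) auto
  moreover have "2 * pi / real k * (of_int (grp a) + 1) = 2 * pi * of_int (grp a) / real k + 2 * pi / real k"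
    "2 * pi / real k * of_int (grp b) = 2 * pi * of_int (grp b) / real k"
    by (simp_all add: distrib_left)
  ultimately have "2 * pi * of_int (grp a) / real k + 2 * pi / real k \<le> 2 * pi * of_int (grp b) / real k"
    by linarith
  moreover have "pi / (4 * real k) + pi / (4 * real k) < 2 * pi / real k" using k3 by (simp add: field_simps)
  ultimately show ?thesis using dev_small[of a] dev_small[of b] unfolding ang_def by linarith
qed

lemma ang_diff_bound: "\<bar>ang b - ang a - 2 * pi * of_int (grp b - grp a) / real k\<bar> < pi / (2 * real k)"
proof -
  have "2 * pi * of_int (grp b - grp a) / real k = 2 * pi * of_int (grp b) / real k - 2 * pi * of_int (grp a) / real k"
    by (simp add: diff_divide_distrib right_diff_distrib)
  moreover have "pi / (2 * real k) = pi / (4 * real k) + pi / (4 * real k)" by (simp add: field_simps)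
  ultimately show ?thesis using dev_small[of a] dev_small[of b] unfolding ang_def by linarith
qed

text \<open>Otherwise the odd integer \<open>k - 2 * (grp b - grp a)\<close> would have absolute
  value below \<open>1 / 2\<close>.\<close>

lemma ang_not_pi: "ang b - ang a \<noteq> pi"
proof
  assume e: "ang b - ang a = pi"
  define x :: int where "x = int k - 2 * (grp b - grp a)"
  have "pi - 2 * pi * of_int (grp b - grp a) / real k = (pi / real k) * of_int x"
    unfolding x_def using k3 by (simp add: field_simps)
  then have "\<bar>(pi / real k) * of_int x\<bar> < (pi / real k) * (1 / 2)"
    using ang_diff_bound[of b a] e by (simp add: field_simps)
  then have "(pi / real k) * \<bar>of_int x\<bar> < (pi / real k) * (1 / 2)"
    using k3 by (simp add: abs_mult)
  then have "\<bar>of_int x :: real\<bar> < 1 / 2" by (rule mult_left_less_imp_less) simp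
  then have "x = 0" by linarith
  then show False using k_h unfolding x_def by presburger
qed

text \<open>At most \<open>h = (k - 1) / 2\<close> group steps make at most
  \<open>pi - pi / k\<close>, and the deviations add less than \<open>pi / (2 * k)\<close>.\<close>

lemma short_arc_ang: assumes "short_arc f h a b" shows "ang b - ang a < pi"
proof -
  obtain j where j: "a < b" "f j \<le> a" "b < f (j + h + 1)" using assms unfolding short_arc_def by auto
  have "grp b - grp a \<le> h" using grp_ge[OF j(2)] grp_le[OF j(3)] by simp
  then have "of_int (grp b - grp a) \<le> (of_int h :: real)" by (simp only: of_int_le_iff)
  moreover have "of_int h = (real k - 1) / 2"
  proof -
    have "real_of_int (int k) = 2 * of_int h + 1" unfolding k_h by simp
    then show ?thesis by simp
  qed
  ultimately have "of_int (grp b - grp a) \<le> (real k - 1) / 2" by simp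
  then have "2 * pi / real k * of_int (grp b - grp a) \<le> 2 * pi / real k * ((real k - 1) / 2)"
    by (intro mult_left_mono) auto
  also have "\<dots> = pi - pi / real k" using k3 by (simp add: field_simps)
  finally have "2 * pi * of_int (grp b - grp a) / real k \<le> pi - pi / real k" by simp
  moreover have "pi / (2 * real k) < pi / real k" using k3 by (simp add: field_simps)
  ultimately show ?thesis using ang_diff_bound[of b a] by linarith
qed

sublocale angular_sequence pt ang "\<lambda>a. cmod (pt a - v) / cmod z" m v z
proof
  show "pt a - v = z * (of_real (cmod (pt a - v) / cmod z) * cis (ang a))" for a
  proof -
    have "grp a = int (res a) + int k * (grp a div int k)" unfolding res_def using k3 by simp
    then have "real_of_int (grp a) = real (res a) + real k * of_int (grp a div int k)"
      by (metis of_int_add of_int_mult of_int_of_nat_eq)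
    then have "2 * pi * of_int (grp a) / real k = 2 * pi * real (res a) / real k + 2 * pi * of_int (grp a div int k)"
      using k3 by (simp add: field_simps)
    then have "cis (ang a) = cis (2 * pi * real (res a) / real k) * cis (dev (res a) (pt a))"
      unfolding ang_def by (simp add: cis_multiple_2pi flip: cis_mult)
    then show ?thesis using G_polar[OF res_less pt_G, of a] unfolding dir_def by (simp add: ac_simps)
  qed
  show "0 < cmod (pt a - v) / cmod z" for a using pt_v[of a] z0 by simp
  show "z \<noteq> 0" by (rule z0)
  show "ang a < ang b" if "a < b" for a b using that by (rule ang_mono)
  show "ang (a + m) = ang a + 2 * pi" for a by (rule ang_per)
  show "pt (a + m) = pt a" for a by (rule pt_per)
  show "ang b - ang a \<noteq> pi" for a b by (rule ang_not_pi)
  show "pt b \<notin> convex hull {v, pt a, pt c}" if ne: "pt b \<noteq> pt a" "pt b \<noteq> pt c" for a b c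
  proof -
    let ?S = "convex hull V"
    \<comment> \<open>The hull without an extreme point is still convex, and it contains the three
      other points.\<close>
    have "pt b extreme_point_of ?S"
      using gw res_less[of b] pt_G[of b] unfolding generalized_wheel_def V_def k_eq by blast
    then have cv: "convex (?S - {pt b})" using extreme_point_of_stillconvex[of ?S "pt b"] by simp
    have "{v, pt a, pt c} \<subseteq> ?S - {pt b}"
      using ne pt_v[of b] v_V pt_V hull_inc[of _ V convex] by auto
    then have "convex hull {v, pt a, pt c} \<subseteq> ?S - {pt b}" using cv by (rule hull_minimal)
    then show ?thesis by blast
  qed
qed

lemma pt_shift: "pt (a + x * m) = pt a"
proof -
  have nat: "pt (a + int d * m) = pt a" for a d
  proof (induction d)
    case (Suc d)
    then show ?case using pt_per[of "a + int d * m"] by (simp add: algebra_simps)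
  qed simp
  show ?thesis
  proof (cases "x \<ge> 0")
    case True then show ?thesis using nat[of a "nat x"] by simp
  next
    case False then show ?thesis using nat[of "a + x * m" "nat (- x)"] by (simp add: algebra_simps)
  qed
qed

lemma short_arc_less: assumes "short_arc f h a b" shows "b < a + m"
proof -
  obtain j where "f j \<le> a" "b < f (j + h + 1)" using assms unfolding short_arc_def by auto
  then show ?thesis using window_le[of j] n_ge unfolding m_def by linarith
qed

lemma V_finite: "finite V" and V_card: "card V = 2 * n"
proof -
  have dj: "disjoint_family_on G {..<k}" using gw unfolding generalized_wheel_def k_eq by simp
  have V: "V = insert v (\<Union>i<k. G i)" unfolding V_def wheel_points_def k_eq ..
  show "finite V" unfolding V using G_finite by auto
  have "card (\<Union>i<k. G i) = (\<Sum>i<k. card (G i))"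
    using dj G_finite by (intro card_UN_disjoint) (auto simp: disjoint_family_on_def)
  also have "\<dots> = (\<Sum>i<k. N ! i)" using G_card by simp
  finally show "card V = 2 * n"
    unfolding V using G_finite G_not_center n_eq by (subst card_insert_disjoint) auto
qed

text \<open>The trees of a partition serve as colors of a \<open>wheel_coloring\<close>, which is
  then refuted by \<open>wheel_core.contradiction\<close>.\<close>

lemma no_partition: "\<not> partitionable_into_plane_spanning_trees V (complete_edges V)"
proof
  assume "partitionable_into_plane_spanning_trees V (complete_edges V)"
  then obtain \<T> where part: "partition_on (complete_edges V) \<T>"
    and tree: "\<And>T. T \<in> \<T> \<Longrightarrow> spanning_tree V (complete_edges V) T"
    and plane: "\<And>T. T \<in> \<T> \<Longrightarrow> plane_edges T"
    unfolding partitionable_into_plane_spanning_trees_def by blast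
  have finE: "finite (complete_edges V)"
    unfolding complete_edges_eq using V_finite by (auto intro: finite_subset[of _ "Pow V"])
  have Un: "\<Union>\<T> = complete_edges V" and dj: "disjoint \<T>" using part unfolding partition_on_def by auto
  have uniq: "\<exists>!T. T \<in> \<T> \<and> e \<in> T" if "e \<in> complete_edges V" for e
  proof (rule ex_ex1I)
    show "\<exists>T. T \<in> \<T> \<and> e \<in> T" using that unfolding Un[symmetric] by blast
    show "T = T'" if "T \<in> \<T> \<and> e \<in> T" "T' \<in> \<T> \<and> e \<in> T'" for T T'
      using disjointD[OF dj, of T T'] that by blast
  qed
  \<comment> \<open>Degenerate pairs get an unspecified value; only periodicity is claimed for
    them.\<close>
  define col where "col a b = (THE T. T \<in> \<T> \<and> {pt a, pt b} \<in> T)" for a b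
  define rc where "rc a = (THE T. T \<in> \<T> \<and> {v, pt a} \<in> T)" for a
  have chord: "{pt a, pt b} \<in> complete_edges V" if "short_arc f h a b" for a b
  proof -
    have "a < b" using that unfolding short_arc_def by simp
    then have "pt a \<noteq> pt b" using P_neq[of a b] short_arc_less[OF that] by simp
    then show ?thesis unfolding complete_edges_def using pt_V by blast
  qed
  have radial: "{v, pt a} \<in> complete_edges V" for a
    unfolding complete_edges_def using pt_V v_V pt_v[of a] by blast
  have col: "col a b \<in> \<T> \<and> {pt a, pt b} \<in> col a b" if "short_arc f h a b" for a b
    unfolding col_def by (rule theI'[OF uniq[OF chord[OF that]]])
  have colI: "col a b = T" if "T \<in> \<T>" "{pt a, pt b} \<in> T" for a b T
  proof -
    have "{pt a, pt b} \<in> complete_edges V" using that unfolding Un[symmetric] by blast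
    then show ?thesis unfolding col_def using that by (intro the1_equality[OF uniq]) auto
  qed
  have rc: "rc a \<in> \<T> \<and> {v, pt a} \<in> rc a" for a
    unfolding rc_def by (rule theI'[OF uniq[OF radial]])
  have rcI: "rc a = T" if "T \<in> \<T>" "{v, pt a} \<in> T" for a T
  proof -
    have "{v, pt a} \<in> complete_edges V" using that unfolding Un[symmetric] by blast
    then show ?thesis unfolding rc_def using that by (intro the1_equality[OF uniq]) auto
  qed
  have fin: "finite \<T>" using finE unfolding Un[symmetric] by (rule finite_UnionD)
  have "wheel_coloring f m (int n) h col rc \<T>"
  proof
    show "finite \<T>" by (rule fin)
    show "int n \<le> int (card \<T>)"
    proof -
      have n0: "0 < n" using n_eq by simp
      have "V \<noteq> {}" using v_V by auto
      then have c: "card T \<le> 2 * n - 1" if "T \<in> \<T>" for T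
        using acyclic_card[OF V_finite, of T] tree[OF that] V_card unfolding spanning_tree_def by fastforce
      \<comment> \<open>There are \<open>n * (2 * n - 1)\<close> edges and each tree has at most
        \<open>2 * n - 1\<close> of them.\<close>
      have "2 * n * (2 * n - 1) = 2 * (2 * n choose 2)" using choose_two[of "2 * n"] by simp
      then have "n * (2 * n - 1) = 2 * n choose 2" by simp
      also have "\<dots> = card (\<Union>\<T>)" unfolding Un card_complete_edges[OF V_finite] V_card ..
      also have "\<dots> = (\<Sum>T\<in>\<T>. card T)"
        using dj Un finE by (intro card_Union_disjoint) (auto simp: disjoint_def pairwise_def disjnt_def intro: finite_subset)
      also have "\<dots> \<le> card \<T> * (2 * n - 1)" using sum_bounded_above[of \<T> card "2 * n - 1"] c by simp
      finally show ?thesis using n0 by simp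
    qed
    show "col a b \<in> \<T>" if "short_arc f h a b" for a b using col[OF that] by simp
    show "rc a \<in> \<T>" for a using rc by simp
    show "col (a + m) (b + m) = col a b" for a b unfolding col_def pt_per ..
    show "rc (a + m) = rc a" for a unfolding rc_def pt_per ..
    show False if ab: "short_arc f h a b" and cd: "short_arc f h c d" and e: "col a b = col c d"
      and o: "a < c" "c < b" "b < d" for a b c d
    proof -
      obtain j where j: "f j \<le> a" "b < f (j + h + 1)" using ab unfolding short_arc_def by auto
      obtain i where i: "f i \<le> c" "d < f (i + h + 1)" using cd unfolding short_arc_def by auto
      \<comment> \<open>The windows make the second arc end within one turn after \<open>a\<close>,
        as \<open>chords_cross\<close> requires.\<close>
      have "f i < f (j + h + 1)" using i j o by linarith
      then have "i + h + 1 \<le> j + (2 * h + 1)" by (simp add: f_less_iff)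
      then have "f (i + h + 1) \<le> f j + m" using f_le[of "i + h + 1" "j + (2 * h + 1)"] f_per by simp
      then have d: "d < a + m" using i j by linarith
      have "pt c \<noteq> pt a" "pt c \<noteq> pt b" using P_neq[of a c] P_neq[of c b] o d by force+
      then have "{pt a, pt b} \<noteq> {pt c, pt d}" by blast
      then have "open_segment (pt a) (pt b) \<inter> open_segment (pt c) (pt d) = {}"
        using plane[unfolded plane_edges_def, rule_format, of "col a b" "pt a" "pt b" "pt c" "pt d"] col[OF ab] col[OF cd] e
        by simp
      then show False using chords_cross[OF o d] by simp
    qed
    show "rc c \<noteq> col a b" if ab: "short_arc f h a b" and o: "a < c" "c < b" for a b c
    proof
      assume e: "rc c = col a b"
      have "{v, pt c} \<noteq> {pt a, pt b}" using pt_v[of a] pt_v[of b] by (auto simp: doubleton_eq_iff)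
      then have "open_segment v (pt c) \<inter> open_segment (pt a) (pt b) = {}"
        using plane[unfolded plane_edges_def, rule_format, of "col a b" v "pt c" "pt a" "pt b"] col[OF ab] rc[of c] e
        by simp
      then show False using radial_chord_cross[OF o short_arc_less[OF ab] short_arc_ang[OF ab]] by simp
    qed
    show "\<exists>a b. short_arc f h a b \<and> col a b = T \<and> (a \<in> S) \<noteq> (b \<in> S)"
      if T: "T \<in> \<T>" and S: "\<And>x. (x + m \<in> S) = (x \<in> S)" "S \<noteq> {}" and nr: "\<And>x. x \<in> S \<Longrightarrow> rc x \<noteq> T" for T S
    proof -
      obtain s where s: "s \<in> S" using S(2) by auto
      \<comment> \<open>A path to the center leaves the image of \<open>S\<close>. The edge by which
        it leaves is not radial, so it is a chord.\<close>
      have path: "(pt s, v) \<in> {(x, y). {x, y} \<in> T}\<^sup>*"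
        using tree[OF T] pt_V v_V unfolding spanning_tree_def connected_graph_def by blast
      have vS: "v \<notin> pt ` S" using pt_v by (metis imageE)
      have sS: "pt s \<in> pt ` S" using s by simp
      obtain x y where "(x, y) \<in> {(x, y). {x, y} \<in> T}" and xy2: "x \<in> pt ` S" "y \<notin> pt ` S"
        by (rule rtrancl_leaves[OF path sS vS])
      then have xy: "{x, y} \<in> T" "x \<in> pt ` S" "y \<notin> pt ` S" by simp_all
      obtain a where a: "a \<in> S" "x = pt a" using xy(2) by auto
      have yV: "y \<in> V" "y \<noteq> x" using tree[OF T] xy(1) unfolding spanning_tree_def complete_edges_def
        by (auto simp: doubleton_eq_iff)
      have "y \<noteq> v" using nr[OF a(1)] rcI[OF T, of a] xy(1) a(2) by (auto simp: insert_commute)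
      then obtain b0 where b0: "y = pt b0" using pt_surj[OF yV(1)] by auto
      obtain w where w: "a \<le> b0 + w * m" "b0 + w * m < a + m" by (rule shift_into)
      define b where "b = b0 + w * m"
      have yb: "y = pt b" unfolding b_def pt_shift by (rule b0)
      have "a \<noteq> b" using yV(2) yb a by auto
      then have ab: "a < b" "b < a + m" using w unfolding b_def by auto
      have bS: "b \<notin> S" using xy(3) yb by auto
      \<comment> \<open>With \<open>b\<close> chosen in the turn after \<open>a\<close>, exactly the
        position of \<open>b\<close> relative to the window of \<open>a\<close> decides which side
        of the chord is taken as the short arc.\<close>
      show ?thesis
      proof (cases "b < f (grp a + h + 1)")
        case True
        then have "short_arc f h a b" using ab grp[of a] unfolding short_arc_def by auto
        moreover have "col a b = T" using colI[OF T] xy(1) a yb by simp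
        ultimately show ?thesis using a bS by blast
      next
        case False
        have "a + m < f (grp a + h + 1 + h + 1)"
          using grp(2)[of a] f_per[of "grp a + 1"] by (simp add: algebra_simps)
        then have "short_arc f h b (a + m)"
          using window_short[of "grp a + h + 1" b "a + m"] ab False by linarith
        moreover have "col b (a + m) = T" using colI[OF T] xy(1) a yb pt_per by (simp add: insert_commute)
        moreover have "a + m \<in> S" using S(1) a by simp
        ultimately show ?thesis using bS by blast
      qed
    qed
  qed
  then interpret W: wheel_coloring f m "int n" h col rc \<T> .
  obtain i t0 t1 where "wheel_core (\<lambda>j. f (i + j)) m (int n) h col rc \<T> t0 t1"
    using W.wheel_core_exists by blast
  then show False by (rule wheel_core.contradiction)
qed

end

theorem theorem3:
  fixes N :: "nat list" and k n :: nat and v0 z :: complex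
  assumes "k = length N" and "3 \<le> k" and "odd k"
    and "\<forall>i<k. 1 \<le> N ! i"
    and "odd (\<Sum>i<k. N ! i)"
    and "2 * n = 1 + (\<Sum>i<k. N ! i)"
    and "z \<noteq> 0"
    and "\<forall>j<k. int (\<Sum>i<(k - 1) div 2. N ! ((j + i) mod k)) < int n - 2"
  shows "\<forall>\<^sub>F \<epsilon> in at_right 0. \<forall>G. generalized_wheel N v0 z \<epsilon> G \<longrightarrow>
    \<not> partitionable_into_plane_spanning_trees (wheel_points N v0 G)
        (complete_edges (wheel_points N v0 G))"
proof -
  have "0 < pi / (4 * real k)" using assms(2) by simp
  then obtain \<delta> where \<delta>: "0 < \<delta>" "\<And>w. cmod w < \<delta> \<Longrightarrow> 1 + w \<noteq> 0 \<and> \<bar>Arg (1 + w)\<bar> < pi / (4 * real k)"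
    using Arg_near_one by blast
  \<comment> \<open>Divided by its direction, a point deviates from \<open>1\<close> by less than
    \<open>\<epsilon> / cmod z\<close>, whence this bound.\<close>
  have "0 < \<delta> * cmod z" using \<delta>(1) assms(7) by simp
  then have "\<forall>\<^sub>F \<epsilon> in at_right 0. \<epsilon> \<in> {0<..<\<delta> * cmod z}" by (rule eventually_at_right_real)
  then show ?thesis
  proof (rule eventually_mono)
    fix \<epsilon> assume \<epsilon>: "\<epsilon> \<in> {0<..<\<delta> * cmod z}"
    show "\<forall>G. generalized_wheel N v0 z \<epsilon> G \<longrightarrow>
      \<not> partitionable_into_plane_spanning_trees (wheel_points N v0 G) (complete_edges (wheel_points N v0 G))"
    proof (intro allI impI)
      fix G assume gw: "generalized_wheel N v0 z \<epsilon> G"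
      have "\<epsilon> / cmod z < \<delta>" using \<epsilon> assms(7) by (simp add: pos_divide_less_eq)
      then interpret geometric_wheel N k n v0 z \<epsilon> G
        by unfold_locales (use assms gw \<delta>(2) in auto)
      show "\<not> partitionable_into_plane_spanning_trees (wheel_points N v0 G) (complete_edges (wheel_points N v0 G))"
        using no_partition unfolding V_def .
    qed
  qed
qed

end
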